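(* For any positive integer $t\ge 2$ and fields $K$ and $K'$, there is a digraph $\mathbb{E}_t$ such that \[ \dim(\Omega_4(\mathbb{E}_t;K))=\begin{cases}1 & \text{if } K=\mathbb{Z}_{p_j} \text{ for } j\in\{1,\dots,k\},\\ 0 & \text{otherwise,}\end{cases} \] where $t=p_1^{i_1}\cdots p_k^{i_k}$ is the prime decomposition of $t$ ($p_1,\dots,p_k$ distinct primes, $i_1,\dots,i_k$ positive integers), and \[ \dim(\Omega_i(\mathbb{E}_t;K))=\dim(\Omega_i(\mathbb{E}_t;K')) \] for $i\neq 4$.
   Context: For a prime $p$, $\mathbb{Z}_p$ denotes the finite field with $p$ elements. A digraph $G=(V_G,E_G)$ is a set $V_G$ of vertices with a set of edges $E_G\subseteq\{(u,v)\in V_G\times V_G: u\neq v\}$. Let $R$ be a commutative ring with unit. For $n\ge 0$, an (allowed) $n$-path in $G$ is a sequence of vertices, written $e_{v_0,\dots,v_n}$, with $(v_{i-1},v_i)\in E_G$ for $i=1,\dots,n$. Let $\mathcal{R}_n$ be the free $R$-module on all sequences $e_{v_0,\dots,v_n}$ in $V_G$ modulo the span of those with $v_{i-1}=v_i$ for some $i$, with differential $\partial^P_n(e_{v_0,\dots,v_n})=\sum_{i=0}^n(-1)^i e_{v_0,\dots,\hat v_i,\dots,v_n}$, where $\hat v_i$ means $v_i$ is omitted (and $\mathcal{R}_n=0$ for $n<0$). Let $\mathcal{A}_n(G;R)\subseteq\mathcal{R}_n$ be the free submodule spanned by the allowed $n$-paths. The path chains of dimension $n$ are $\Omega_n(G;R)=\{x\in\mathcal{A}_n(G;R):\partial^P_n(x)\in\mathcal{A}_{n-1}(G;R)\}$,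 with $\Omega_n(G;R)=0$ for $n<0$. Dimensions are taken as vector spaces over the coefficient field.
   Formalization: "K = Z_{p_j}" is read as "K has characteristic p_j": one digraph for all fields cannot separate F_4 from Z_2 (t=2), since dimensions depend only on the prime field. The digraph is chosen for fields in given carrier types; a countable type suffices by invariance under field extension. *)

theory Defs
  imports
    Jordan_Normal_Form.Missing_VectorSpace
    Graph_Theory.Pair_Digraph
    "HOL-Algebra.QuotRing"
    "HOL-Number_Theory.Residues"
begin

section \<open>Free modules\<close>

text \<open>
  The free \<open>R\<close>-module on \<open>S\<close>, as finitely supported coefficient functions. Functions vanish
  outside \<open>S\<close>, so for \<open>S \<subseteq> T\<close> the free module on \<open>S\<close> is literally a submodule of the one
  on \<open>T\<close>. The fields \<open>monoid.mult\<close> and \<open>one\<close>, which the record type of modules inherits from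
  rings, have no meaning for modules.
\<close>

definition free_module :: "('a, 'm) ring_scheme \<Rightarrow> 'b set \<Rightarrow> ('a, 'b \<Rightarrow> 'a) module" where
  "free_module R S =
    \<lparr> carrier = {f. (\<forall>x\<in>S. f x \<in> carrier R) \<and> (\<forall>x. x \<notin> S \<longrightarrow> f x = \<zero>\<^bsub>R\<^esub>)
                  \<and> finite {x. f x \<noteq> \<zero>\<^bsub>R\<^esub>}},
      monoid.mult = undefined,
      one = undefined,
      zero = (\<lambda>_. \<zero>\<^bsub>R\<^esub>),
      add = (\<lambda>f g x. f x \<oplus>\<^bsub>R\<^esub> g x),
      smult = (\<lambda>a f x. a \<otimes>\<^bsub>R\<^esub> f x) \<rparr>"


section \<open>Path chains of a digraph\<close>

text \<open>
  A digraph with vertex set \<open>pverts G\<close>, edge set \<open>parcs G \<subseteq> pverts G \<times> pverts G\<close> and no loops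
  is a \<^locale>\<open>pair_loopfree_digraph\<close>; a finite one is a \<^locale>\<open>pair_digraph\<close>.

  The sequence \<open>(v\<^sub>0, \<dots>, v\<^sub>n)\<close> is a list of length \<open>n + 1\<close>. The empty list is excluded, so
  that there are no sequences, hence no chains, of any dimension \<open>n < 0\<close>.
\<close>

definition vertex_seqs :: "'v set \<Rightarrow> int \<Rightarrow> 'v list set" where
  "vertex_seqs V n = {vs. vs \<noteq> [] \<and> int (length vs) = n + 1 \<and> set vs \<subseteq> V}"

definition regular_seqs :: "'v set \<Rightarrow> int \<Rightarrow> 'v list set" where
  "regular_seqs V n = {vs \<in> vertex_seqs V n. successively (\<noteq>) vs}"

definition allowed_paths :: "'v pair_pre_digraph \<Rightarrow> int \<Rightarrow> 'v list set" where
  "allowed_paths G n =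
    {vs \<in> vertex_seqs (pverts G) n. successively (\<lambda>u v. (u, v) \<in> parcs G) vs}"

text \<open>
  The free module on all sequences modulo the span of the sequences with \<open>v\<^sub>i\<^sub>-\<^sub>1 = v\<^sub>i\<close> for some
  \<open>i\<close> is realised as the free module on the remaining (regular) sequences. The class of a
  sequence in the quotient is then the corresponding basis vector if the sequence is regular,
  and zero otherwise.
\<close>

definition path_module ::
    "('a, 'm) ring_scheme \<Rightarrow> 'v set \<Rightarrow> int \<Rightarrow> ('a, 'v list \<Rightarrow> 'a) module" where
  "path_module R V n = free_module R (regular_seqs V n)"

definition path_class ::
    "('a, 'm) ring_scheme \<Rightarrow> 'v set \<Rightarrow> int \<Rightarrow> 'v list \<Rightarrow> 'v list \<Rightarrow> 'a" where
  "path_class R V n vs =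
    (\<lambda>ws. if vs \<in> regular_seqs V n \<and> ws = vs then \<one>\<^bsub>R\<^esub> else \<zero>\<^bsub>R\<^esub>)"

definition omit_nth :: "nat \<Rightarrow> 'v list \<Rightarrow> 'v list" where
  "omit_nth i vs = take i vs @ drop (Suc i) vs"

text \<open>
  \<open>path_boundary_gen R V n vs\<close> is the boundary of the single sequence \<open>vs\<close>, and
  \<open>path_boundary R V n\<close> its linear extension. For \<open>n = 0\<close> the only face is the empty
  list, whose class is zero.
\<close>

definition path_boundary_gen ::
    "('a, 'm) ring_scheme \<Rightarrow> 'v set \<Rightarrow> int \<Rightarrow> 'v list \<Rightarrow> 'v list \<Rightarrow> 'a" where
  "path_boundary_gen R V n vs =
    (\<Oplus>\<^bsub>path_module R V (n - 1)\<^esub> i \<in> {0..nat n}.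
      ((\<ominus>\<^bsub>R\<^esub> \<one>\<^bsub>R\<^esub>) [^]\<^bsub>R\<^esub> i) \<odot>\<^bsub>path_module R V (n - 1)\<^esub>
        path_class R V (n - 1) (omit_nth i vs))"

definition path_boundary ::
    "('a, 'm) ring_scheme \<Rightarrow> 'v set \<Rightarrow> int \<Rightarrow> ('v list \<Rightarrow> 'a) \<Rightarrow> 'v list \<Rightarrow> 'a" where
  "path_boundary R V n x =
    (\<Oplus>\<^bsub>path_module R V (n - 1)\<^esub> vs \<in> {vs. x vs \<noteq> \<zero>\<^bsub>R\<^esub>}.
      x vs \<odot>\<^bsub>path_module R V (n - 1)\<^esub> path_boundary_gen R V n vs)"

definition allowed_chains ::
    "('a, 'm) ring_scheme \<Rightarrow> 'v pair_pre_digraph \<Rightarrow> int \<Rightarrow> ('v list \<Rightarrow> 'a) set" where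
  "allowed_chains R G n = carrier (free_module R (allowed_paths G n))"

definition path_chains ::
    "('a, 'm) ring_scheme \<Rightarrow> 'v pair_pre_digraph \<Rightarrow> int \<Rightarrow> ('a, 'v list \<Rightarrow> 'a) module" where
  "path_chains R G n = (path_module R (pverts G) n)
    \<lparr> carrier := {x \<in> allowed_chains R G n.
                   path_boundary R (pverts G) n x \<in> allowed_chains R G (n - 1)} \<rparr>"


section \<open>Characteristic of a ring\<close>

text \<open>
  Dimensions of path chains are unchanged under extension of the coefficient field, so for a
  fixed digraph they depend on the field only through its prime field. Accordingly a case
  distinction ``the field is \<open>\<int>/p\<close>'' over arbitrary fields has to be read as ``the prime field
  is \<open>\<int>/p\<close>'', i.e. the characteristic is \<open>p\<close>.
\<close>

definition ring_char :: "('a, 'm) ring_scheme \<Rightarrow> nat" where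
  "ring_char R =
    (if \<exists>n::nat. n > 0 \<and> [n] \<cdot>\<^bsub>R\<^esub> \<one>\<^bsub>R\<^esub> = \<zero>\<^bsub>R\<^esub>
     then (LEAST n::nat. n > 0 \<and> [n] \<cdot>\<^bsub>R\<^esub> \<one>\<^bsub>R\<^esub> = \<zero>\<^bsub>R\<^esub>) else 0)"

lemma ring_char_residue_ring_iso:
  fixes K :: "'a ring"
  assumes "prime p" "field K" "K \<simeq> residue_ring (int p)"
  shows "ring_char K = p"
proof -
  let ?Z = "residue_ring (int p)"
  interpret K: field K by fact
  have p1: "p > 1" using assms(1) prime_gt_1_nat by blast
  obtain h where h: "h \<in> ring_hom K ?Z" and bij: "bij_betw h (carrier K) (carrier ?Z)"
    using assms(3) by (auto simp: is_ring_iso_def ring_iso_def)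
  have h1: "h \<one>\<^bsub>K\<^esub> = 1"
    using ring_hom_one[OF h] by (simp add: residue_ring_def)
  have ha: "h (x \<oplus>\<^bsub>K\<^esub> y) = (h x + h y) mod int p"
    if "x \<in> carrier K" "y \<in> carrier K" for x y
    using ring_hom_add[OF h that] by (simp add: residue_ring_def)
  have inj: "inj_on h (carrier K)" using bij by (rule bij_betw_imp_inj_on)
  have hz: "h \<zero>\<^bsub>K\<^esub> = 0"
  proof -
    have "h \<zero>\<^bsub>K\<^esub> \<in> carrier ?Z" using bij bij_betwE K.zero_closed by blast
    then have r: "0 \<le> h \<zero>\<^bsub>K\<^esub>" "h \<zero>\<^bsub>K\<^esub> < int p"
      by (auto simp: residue_ring_def)
    have "h \<zero>\<^bsub>K\<^esub> = (h \<zero>\<^bsub>K\<^esub> + h \<zero>\<^bsub>K\<^esub>) mod int p"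
      using ha[of "\<zero>\<^bsub>K\<^esub>" "\<zero>\<^bsub>K\<^esub>"] by simp
    then have "[h \<zero>\<^bsub>K\<^esub> + h \<zero>\<^bsub>K\<^esub> = h \<zero>\<^bsub>K\<^esub> + 0] (mod int p)"
      by (metis add.right_neutral cong_mod_left cong_refl)
    then have "[h \<zero>\<^bsub>K\<^esub> = 0] (mod int p)" using cong_add_lcancel by blast
    then show ?thesis using r by (simp add: cong_def)
  qed
  have hn: "h ([n] \<cdot>\<^bsub>K\<^esub> \<one>\<^bsub>K\<^esub>) = int n mod int p" for n :: nat
  proof (induction n)
    case 0 then show ?case by (simp add: hz)
  next
    case (Suc n) then show ?case by (simp add: ha h1 mod_simps add.commute)
  qed
  have key: "[n] \<cdot>\<^bsub>K\<^esub> \<one>\<^bsub>K\<^esub> = \<zero>\<^bsub>K\<^esub> \<longleftrightarrow> p dvd n" for n :: nat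
    using inj_on_eq_iff[OF inj, of "[n] \<cdot>\<^bsub>K\<^esub> \<one>\<^bsub>K\<^esub>" "\<zero>\<^bsub>K\<^esub>"]
    by (simp add: hn hz flip: zmod_int dvd_eq_mod_eq_0)
  have "(LEAST n::nat. n > 0 \<and> p dvd n) = p"
    using p1 by (intro Least_equality) (auto dest: dvd_imp_le)
  moreover have "\<exists>n::nat. n > 0 \<and> p dvd n" using p1 by (intro exI[of _ p]) auto
  ultimately show ?thesis unfolding ring_char_def key by simp
qed


section \<open>Path chains over a field form a vector space\<close>

lemma free_module_support:
  assumes "f \<in> carrier (free_module R S)"
  shows "finite {x. f x \<noteq> \<zero>\<^bsub>R\<^esub>}" "x \<notin> S \<Longrightarrow> f x = \<zero>\<^bsub>R\<^esub>"
  using assms by (auto simp: free_module_def)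

lemma (in cring) free_module_closed:
  assumes "f \<in> carrier (free_module R S)" shows "f x \<in> carrier R"
  using assms by (cases "x \<in> S") (auto simp: free_module_def)

lemma (in cring) module_free_module: "Module.module R (free_module R S)"
proof -
  let ?M = "free_module R S"
  note fin = free_module_support(1)
  note clo = free_module_closed
  have z: "zero ?M = (\<lambda>_. \<zero>)" and a: "add ?M = (\<lambda>f g x. f x \<oplus> g x)"
    and s: "smult ?M = (\<lambda>a f x. a \<otimes> f x)" by (simp_all add: free_module_def)
  have ac: "(\<lambda>x. f x \<oplus> g x) \<in> carrier ?M" if "f \<in> carrier ?M" "g \<in> carrier ?M" for f g
  proof -
    have "finite {x. f x \<oplus> g x \<noteq> \<zero>}"
      by (rule finite_subset[OF _ finite_UnI[OF fin[OF that(1)] fin[OF that(2)]]]) auto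
    then show ?thesis using that by (auto simp: free_module_def)
  qed
  have sc: "(\<lambda>x. c \<otimes> f x) \<in> carrier ?M" if "f \<in> carrier ?M" "c \<in> carrier R" for f c
  proof -
    have "finite {x. c \<otimes> f x \<noteq> \<zero>}"
      by (rule finite_subset[OF _ fin[OF that(1)]]) (use that(2) in auto)
    then show ?thesis using that by (auto simp: free_module_def)
  qed
  have zc: "(\<lambda>_. \<zero>) \<in> carrier ?M" by (simp add: free_module_def)
  have "abelian_group ?M"
  proof (rule abelian_groupI)
    fix x assume x: "x \<in> carrier ?M"
    have "(\<lambda>i. (\<ominus> \<one>) \<otimes> x i) \<in> carrier ?M" by (rule sc[OF x]) simp
    moreover have "(\<ominus> \<one>) \<otimes> x i \<oplus> x i = \<zero>" for i
      using clo[OF x, of i] by (simp add: l_minus l_neg)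
    ultimately show "\<exists>y\<in>carrier ?M. y \<oplus>\<^bsub>?M\<^esub> x = \<zero>\<^bsub>?M\<^esub>"
      unfolding z a by (intro bexI[of _ "\<lambda>i. (\<ominus> \<one>) \<otimes> x i"]) auto
  qed (auto simp: z a ac zc clo fun_eq_iff a_ac)
  then show ?thesis
    by (intro moduleI)
       (auto simp: a s sc clo fun_eq_iff l_distr r_distr m_assoc is_cring)
qed

lemma (in cring) free_module_finsum_apply:
  assumes "finite A" "\<And>i. i \<in> A \<Longrightarrow> f i \<in> carrier (free_module R S)"
  shows "(\<Oplus>\<^bsub>free_module R S\<^esub>i\<in>A. f i) \<in> carrier (free_module R S)"
    and "(\<Oplus>\<^bsub>free_module R S\<^esub>i\<in>A. f i) x = (\<Oplus>i\<in>A. f i x)"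
proof -
  interpret M: Module.module R "free_module R S" by (rule module_free_module)
  show "(\<Oplus>\<^bsub>free_module R S\<^esub>i\<in>A. f i) \<in> carrier (free_module R S)"
    using assms by (auto intro: M.finsum_closed)
  show "(\<Oplus>\<^bsub>free_module R S\<^esub>i\<in>A. f i) x = (\<Oplus>i\<in>A. f i x)"
    using assms
  proof (induction A rule: finite_induct)
    case empty
    have "(\<Oplus>\<^bsub>free_module R S\<^esub>i\<in>{}. f i) = \<zero>\<^bsub>free_module R S\<^esub>"
      by (rule M.finsum_empty)
    then show ?case by (simp add: free_module_def)
  next
    case (insert a A)
    then have "(\<Oplus>\<^bsub>free_module R S\<^esub>i\<in>insert a A. f i) =
        f a \<oplus>\<^bsub>free_module R S\<^esub> (\<Oplus>\<^bsub>free_module R S\<^esub>i\<in>A. f i)"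
      by (intro M.finsum_insert) auto
    moreover have "(\<Oplus>i\<in>insert a A. f i x) = f a x \<oplus> (\<Oplus>i\<in>A. f i x)"
      using insert by (intro finsum_insert) (auto intro: free_module_closed)
    ultimately show ?case using insert by (simp add: free_module_def)
  qed
qed

lemma (in cring) path_class_closed: "path_class R V n vs \<in> carrier (path_module R V n)"
proof -
  have "finite {ws. path_class R V n vs ws \<noteq> \<zero>}"
    by (rule finite_subset[of _ "{vs}"]) (auto simp: path_class_def)
  then show ?thesis by (auto simp: path_module_def free_module_def path_class_def)
qed

lemma (in cring) path_boundary_gen_closed:
  "path_boundary_gen R V n vs \<in> carrier (path_module R V (n - 1))"
proof -
  interpret M: Module.module R "path_module R V (n - 1)"
    unfolding path_module_def by (rule module_free_module)
  show ?thesis unfolding path_boundary_gen_def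
    by (intro M.finsum_closed) (auto intro!: M.smult_closed path_class_closed)
qed

lemma (in cring) path_boundary_apply:
  assumes "x \<in> carrier (free_module R S)" "finite A" "{vs. x vs \<noteq> \<zero>} \<subseteq> A"
  shows "path_boundary R V n x ws = (\<Oplus>vs\<in>A. x vs \<otimes> path_boundary_gen R V n vs ws)"
proof -
  let ?M = "path_module R V (n - 1)"
  interpret M: Module.module R ?M
    unfolding path_module_def by (rule module_free_module)
  have x: "x vs \<in> carrier R" for vs using assms(1) by (rule free_module_closed)
  have g: "path_boundary_gen R V n vs ws \<in> carrier R" for vs
    using path_boundary_gen_closed unfolding path_module_def by (rule free_module_closed)
  have "path_boundary R V n x ws =
      (\<Oplus>vs\<in>{vs. x vs \<noteq> \<zero>}. (x vs \<odot>\<^bsub>?M\<^esub> path_boundary_gen R V n vs) ws)"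
    unfolding path_boundary_def path_module_def
    by (rule free_module_finsum_apply(2))
       (auto intro!: M.smult_closed[unfolded path_module_def]
          path_boundary_gen_closed[unfolded path_module_def] x
          intro: finite_subset[OF assms(3,2)])
  also have "\<dots> = (\<Oplus>vs\<in>{vs. x vs \<noteq> \<zero>}. x vs \<otimes> path_boundary_gen R V n vs ws)"
    by (simp add: path_module_def free_module_def)
  also have "\<dots> = (\<Oplus>vs\<in>A. x vs \<otimes> path_boundary_gen R V n vs ws)"
    by (rule add.finprod_mono_neutral_cong_left) (use assms x g in auto)
  finally show ?thesis .
qed

lemma (in cring) submodule_path_chains:
  assumes "pair_loopfree_digraph G"
  shows "submodule R (carrier (path_chains R G n)) (path_module R (pverts G) n)"
proof -
  interpret G: pair_loopfree_digraph G by fact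
  let ?V = "pverts G" and ?M = "path_module R (pverts G) n"
  interpret M: Module.module R ?M
    unfolding path_module_def by (rule module_free_module)
  have mod: "Module.module R (free_module R (allowed_paths G m))" for m
    by (rule module_free_module)
  have sub: "allowed_paths G n \<subseteq> regular_seqs ?V n"
  proof
    fix vs assume "vs \<in> allowed_paths G n"
    then have "vs \<in> vertex_seqs ?V n" "successively (\<lambda>u v. (u, v) \<in> parcs G) vs"
      by (simp_all add: allowed_paths_def)
    moreover have "u \<noteq> v" if "(u, v) \<in> parcs G" for u v
      using G.pair_no_loops[OF that] by simp
    ultimately show "vs \<in> regular_seqs ?V n"
      unfolding regular_seqs_def using successively_mono[of "\<lambda>u v. (u, v) \<in> parcs G" vs "(\<noteq>)"] by simp
  qed
  have A: "x \<in> carrier (free_module R (allowed_paths G m))" if "x \<in> allowed_chains R G m"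
    for x m using that by (simp add: allowed_chains_def)
  have fa: "(\<lambda>ws. x ws \<oplus> y ws) \<in> allowed_chains R G m"
    if "x \<in> allowed_chains R G m" "y \<in> allowed_chains R G m" for x y m
  proof -
    interpret N: Module.module R "free_module R (allowed_paths G m)" by (rule mod)
    show ?thesis using N.a_closed[OF A[OF that(1)] A[OF that(2)]]
      by (simp add: allowed_chains_def free_module_def)
  qed
  have fs: "(\<lambda>ws. c \<otimes> x ws) \<in> allowed_chains R G m"
    if "x \<in> allowed_chains R G m" "c \<in> carrier R" for x c m
  proof -
    interpret N: Module.module R "free_module R (allowed_paths G m)" by (rule mod)
    show ?thesis using N.smult_closed[OF that(2) A[OF that(1)]]
      by (simp add: allowed_chains_def free_module_def)
  qed
  have fz: "(\<lambda>_. \<zero>) \<in> allowed_chains R G m" for m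
    by (simp add: allowed_chains_def free_module_def)
  have g: "path_boundary_gen R ?V n vs ws \<in> carrier R" for vs ws
    using path_boundary_gen_closed unfolding path_module_def by (rule free_module_closed)
  have ba: "path_boundary R ?V n (\<lambda>ws. x ws \<oplus> y ws) =
      (\<lambda>ws. path_boundary R ?V n x ws \<oplus> path_boundary R ?V n y ws)"
    if x: "x \<in> allowed_chains R G n" and y: "y \<in> allowed_chains R G n" for x y
  proof
    fix ws
    let ?A = "{vs. x vs \<noteq> \<zero>} \<union> {vs. y vs \<noteq> \<zero>}"
    have f: "finite ?A"
      using free_module_support(1)[OF A[OF x]] free_module_support(1)[OF A[OF y]]
      by simp
    have cl: "x v \<in> carrier R" "y v \<in> carrier R" for v
      using A[OF x] A[OF y] by (auto intro: free_module_closed)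
    have "path_boundary R ?V n (\<lambda>ws. x ws \<oplus> y ws) ws =
        (\<Oplus>vs\<in>?A. (x vs \<oplus> y vs) \<otimes> path_boundary_gen R ?V n vs ws)"
      by (rule path_boundary_apply[OF A[OF fa[OF x y]] f]) auto
    also have "\<dots> = (\<Oplus>vs\<in>?A. x vs \<otimes> path_boundary_gen R ?V n vs ws \<oplus>
        y vs \<otimes> path_boundary_gen R ?V n vs ws)"
      by (intro finsum_cong') (auto simp: cl g l_distr)
    also have "\<dots> = (\<Oplus>vs\<in>?A. x vs \<otimes> path_boundary_gen R ?V n vs ws) \<oplus>
        (\<Oplus>vs\<in>?A. y vs \<otimes> path_boundary_gen R ?V n vs ws)"
      by (intro finsum_addf) (auto simp: cl g)
    also have "\<dots> = path_boundary R ?V n x ws \<oplus> path_boundary R ?V n y ws"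
      using path_boundary_apply[OF A[OF x] f, of ?V n ws]
        path_boundary_apply[OF A[OF y] f, of ?V n ws] by auto
    finally show "path_boundary R ?V n (\<lambda>ws. x ws \<oplus> y ws) ws =
      path_boundary R ?V n x ws \<oplus> path_boundary R ?V n y ws" .
  qed
  have bs: "path_boundary R ?V n (\<lambda>ws. c \<otimes> x ws) =
      (\<lambda>ws. c \<otimes> path_boundary R ?V n x ws)"
    if x: "x \<in> allowed_chains R G n" and c: "c \<in> carrier R" for x c
  proof
    fix ws
    let ?A = "{vs. x vs \<noteq> \<zero>}"
    have f: "finite ?A"
      using free_module_support(1)[OF A[OF x]] .
    have cl: "x v \<in> carrier R" for v
      using A[OF x] by (auto intro: free_module_closed)
    have "path_boundary R ?V n (\<lambda>ws. c \<otimes> x ws) ws =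
        (\<Oplus>vs\<in>?A. (c \<otimes> x vs) \<otimes> path_boundary_gen R ?V n vs ws)"
      by (rule path_boundary_apply[OF A[OF fs[OF x c]] f]) (use c in auto)
    also have "\<dots> = (\<Oplus>vs\<in>?A. c \<otimes> (x vs \<otimes> path_boundary_gen R ?V n vs ws))"
      by (intro finsum_cong') (auto simp: cl c g m_assoc)
    also have "\<dots> = c \<otimes> (\<Oplus>vs\<in>?A. x vs \<otimes> path_boundary_gen R ?V n vs ws)"
      by (intro finsum_rdistr[symmetric]) (auto simp: cl c g f)
    also have "\<dots> = c \<otimes> path_boundary R ?V n x ws"
      using path_boundary_apply[OF A[OF x] f, of ?V n ws] by auto
    finally show "path_boundary R ?V n (\<lambda>ws. c \<otimes> x ws) ws =
      c \<otimes> path_boundary R ?V n x ws" .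
  qed
  have bz: "path_boundary R ?V n (\<lambda>_. \<zero>) = (\<lambda>_. \<zero>)"
    by (simp add: path_boundary_def path_module_def free_module_def finsum_def finprod_def)
  have car: "carrier (path_chains R G n) = {x \<in> allowed_chains R G n.
      path_boundary R ?V n x \<in> allowed_chains R G (n - 1)}"
    by (simp add: path_chains_def)
  have incl: "carrier (path_chains R G n) \<subseteq> carrier ?M"
  proof
    fix x assume "x \<in> carrier (path_chains R G n)"
    then have x: "x \<in> carrier (free_module R (allowed_paths G n))"
      by (simp add: car allowed_chains_def)
    have "x vs = \<zero>" if "vs \<notin> regular_seqs ?V n" for vs
      using that sub by (intro free_module_support(2)[OF x]) blast
    then show "x \<in> carrier ?M"
      using free_module_support(1)[OF x] free_module_closed[OF x]
      by (simp add: path_module_def free_module_def)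
  qed
  have add: "add ?M = (\<lambda>f g x. f x \<oplus> g x)" and zero: "zero ?M = (\<lambda>_. \<zero>)"
    and smult: "smult ?M = (\<lambda>a f x. a \<otimes> f x)"
    by (simp_all add: path_module_def free_module_def)
  have smc: "(\<lambda>ws. c \<otimes> x ws) \<in> carrier (path_chains R G n)"
    if "c \<in> carrier R" "x \<in> carrier (path_chains R G n)" for c x
    using that by (auto simp: car fs bs)
  show ?thesis
  proof (rule LinearCombinations.submodule.intro[OF M.module_axioms incl])
    fix c x assume "c \<in> carrier R" "x \<in> carrier (path_chains R G n)"
    then show "c \<odot>\<^bsub>?M\<^esub> x \<in> carrier (path_chains R G n)"
      unfolding smult by (rule smc)
  qed (auto simp: add zero car fa fz ba bz)
qed

lemma vectorspace_path_chains:
  assumes "field K" "pair_loopfree_digraph G"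
  shows "vectorspace K (path_chains K G n)"
proof -
  interpret K: field K by fact
  interpret M: vectorspace K "path_module K (pverts G) n"
    unfolding vectorspace_def path_module_def
    using K.module_free_module assms(1) by blast
  have "vectorspace K (M.vs (carrier (path_chains K G n)))"
    by (rule M.subspace_is_vs)
       (simp add: VectorSpace.subspace_def M.vectorspace_axioms K.submodule_path_chains assms)
  then show ?thesis by (simp add: path_chains_def)
qed

end

theory Submission
  imports Defs "HOL-Library.Countable"
begin

text \<open>
  A digraph in five layers with a single source and a single sink is considered. A vertex of the
  middle layer with in-neighbours \<open>u, u'\<close> and out-neighbours \<open>v, v'\<close> contributes the
  multiples of \<open>(u - u') \<otimes> (v - v')\<close> to the 4-chains, that is, the boundary of a square
  glued into the complete bipartite graph on layers 1 and 3; vanishing of the remaining interior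
  face makes \<open>\<Omega>\<^sub>4\<close> the second homology of the resulting square complex. The squares are chosen to
  form a Moore space: a disc whose boundary winds \<open>t\<close> times around a 4-cycle, so that
  \<open>\<Omega>\<^sub>4\<close> is the kernel of multiplication by \<open>t\<close> on the field. In dimension at most 3
  every path has at most two interior faces, so the chains form the cycle space of a graph, whose
  dimension does not see the field; in dimension at least 5 there are no paths.
\<close>

section \<open>Coordinates and dimension\<close>

text \<open>The two fields live on different types and need not be related, so no map between the
  chain spaces is at hand. Dimension is therefore certified by a set \<open>F\<close> of positions
  at which values can be prescribed freely and then determine the element. Such a set mentions no
  ring and can serve both fields at once. For a cycle space it is the set of edges outside a
  spanning forest; solving for the forest edges uses only the coefficients 1 and -1. The shape of
  the disc has two reasons. The shortest cycle of a simple bipartite graph has four edges, so a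
  boundary winding \<open>t\<close> times around it has \<open>4 * t\<close> sides; the inner
  polygon has \<open>2 * m\<close> vertices, whence \<open>m = 2 * t\<close>. If the squares at the
  hub were attached to the rim directly, each turn would repeat the same squares, and for
  \<open>t \<ge> 2\<close> the differences of the copies would be cycles over every field. The
  annulus keeps all interior sides of the disc distinct and lets only the rim be covered several
  times.\<close>

definition coordinates :: "('a, 'm) ring_scheme \<Rightarrow> ('e \<Rightarrow> 'a) set \<Rightarrow> 'e set \<Rightarrow> bool" where
  "coordinates R W F \<longleftrightarrow>
    (\<forall>z. (\<forall>e\<in>F. z e \<in> carrier R) \<longrightarrow> (\<exists>!x. x \<in> W \<and> (\<forall>e\<in>F. x e = z e)))"

lemma coordinates_inject:
  assumes "coordinates R W F" "x \<in> W" "y \<in> W"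
    "\<And>e. e \<in> F \<Longrightarrow> x e \<in> carrier R" "\<And>e. e \<in> F \<Longrightarrow> x e = y e"
  shows "x = y"
proof -
  have "\<exists>!u. u \<in> W \<and> (\<forall>e\<in>F. u e = x e)"
    using assms(1,4) unfolding coordinates_def by blast
  then show ?thesis using assms(2,3,5) by (metis (no_types))
qed

lemma dim_eq_card_coordinates:
  fixes K :: "('a, 'm) ring_scheme" (structure) and S :: "'e set"
  assumes K: "field K"
    and vs: "vectorspace K (free_module K S\<lparr>carrier := W\<rparr>)"
    and W: "W \<subseteq> carrier (free_module K S)"
    and F: "finite F" "coordinates K W F"
  shows "vectorspace.dim K (free_module K S\<lparr>carrier := W\<rparr>) = card F"
proof -
  let ?M = "free_module K S\<lparr>carrier := W\<rparr>"
  interpret K: field K by fact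
  interpret V: vectorspace K ?M by fact
  have M: "\<zero>\<^bsub>?M\<^esub> = (\<lambda>_. \<zero>)" "add ?M = (\<lambda>f g x. f x \<oplus> g x)"
    "smult ?M = (\<lambda>a f x. a \<otimes> f x)" "carrier ?M = W"
    by (simp_all add: free_module_def)
  have cl: "x e \<in> carrier K" if "x \<in> W" for x e
    by (rule K.free_module_closed[OF subsetD[OF W that]])
  \<comment> \<open>\<open>w f\<close> is the element dual to \<open>f\<close>: among the positions
    in \<open>F\<close> it is one at \<open>f\<close> and zero elsewhere. These elements will form
    the basis.\<close>
  define w where "w f = (THE x. x \<in> W \<and> (\<forall>e\<in>F. x e = (if e = f then \<one> else \<zero>)))" for f
  have "w f \<in> W \<and> (\<forall>e\<in>F. w f e = (if e = f then \<one> else \<zero>))" for f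
  proof -
    have "\<exists>!x. x \<in> W \<and> (\<forall>e\<in>F. x e = (if e = f then \<one> else \<zero>))"
      using F(2)[unfolded coordinates_def, rule_format, of "\<lambda>e. if e = f then \<one> else \<zero>"] by simp
    from theI'[OF this] show ?thesis unfolding w_def .
  qed
  then have wW: "w f \<in> W" and wF: "e \<in> F \<Longrightarrow> w f e = (if e = f then \<one> else \<zero>)" for e f
    by auto
  have inj: "inj_on w F"
    by (rule inj_onI) (metis wF K.one_not_zero)
  have fs: "(\<Oplus>\<^bsub>?M\<^esub>f\<in>A. g f) e = (\<Oplus>f\<in>A. g f e)" if "finite A" "g \<in> A \<rightarrow> W" for g :: "('e \<Rightarrow> 'a) \<Rightarrow> 'e \<Rightarrow> 'a" and A e
    using that
  proof (induction A rule: finite_induct)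
    case empty
    then show ?case by (simp only: V.M.finsum_empty M K.finsum_empty)
  next
    case (insert a A)
    then have "(\<Oplus>\<^bsub>?M\<^esub>f\<in>insert a A. g f) = g a \<oplus>\<^bsub>?M\<^esub> (\<Oplus>\<^bsub>?M\<^esub>f\<in>A. g f)"
      by (intro V.M.finsum_insert) (auto simp: M)
    moreover have "(\<Oplus>f\<in>insert a A. g f e) = g a e \<oplus> (\<Oplus>f\<in>A. g f e)"
      using insert by (intro K.finsum_insert) (auto intro!: cl)
    ultimately show ?case using insert by (simp add: M)
  qed
  have lc: "V.lincomb a (w ` F) f = a (w f)" if a: "a \<in> w ` F \<rightarrow> carrier K" and f: "f \<in> F" for a f
  proof -
    have aw: "a (w g) \<in> carrier K" if "g \<in> F" for g using a that by auto
    have "V.lincomb a (w ` F) f = (\<Oplus>v\<in>w ` F. a v \<otimes> v f)"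
      unfolding V.lincomb_def using F(1) a V.smult_closed wW
      by (subst fs) (auto simp: M)
    also have "\<dots> = (\<Oplus>g\<in>F. a (w g) \<otimes> w g f)"
      by (rule K.finsum_reindex[OF _ inj]) (auto simp: aw cl[OF wW])
    also have "\<dots> = (\<Oplus>g\<in>F. if f = g then a (w g) else \<zero>)"
      using f by (intro K.finsum_cong') (auto simp: wF aw)
    also have "\<dots> = a (w f)"
      using f F(1) by (intro K.finsum_singleton) (auto simp: aw)
    finally show ?thesis .
  qed
  have sub: "w ` F \<subseteq> carrier ?M" using wW by (auto simp: M)
  have li: "V.lin_indpt (w ` F)"
  proof (rule V.finite_lin_indpt2[OF _ sub])
    show "finite (w ` F)" using F(1) by simp
    fix a assume a: "a \<in> w ` F \<rightarrow> carrier K" and "V.lincomb a (w ` F) = \<zero>\<^bsub>?M\<^esub>"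
    then show "\<forall>v\<in>w ` F. a v = \<zero>" using lc[OF a] by (auto simp: M)
  qed
  have "x \<in> V.span (w ` F)" if x: "x \<in> W" for x
  proof -
    \<comment> \<open>Coefficients are indexed by vectors, so the value of \<open>x\<close> at a
      position is looked up through the inverse of \<open>w\<close>. The combination agrees with
      \<open>x\<close> on \<open>F\<close>, hence equals it.\<close>
    define a where "a v = x (the_inv_into F w v)" for v
    have a: "a \<in> w ` F \<rightarrow> carrier K" using cl x by (auto simp: a_def)
    have lW: "V.lincomb a (w ` F) \<in> W"
      using V.lincomb_closed[OF sub a] by (simp add: M)
    have "V.lincomb a (w ` F) = x"
      by (rule coordinates_inject[OF F(2) lW x])
         (auto simp: lc[OF a] a_def the_inv_into_f_f[OF inj] cl x)
    then show ?thesis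
      using a unfolding V.span_def by (auto intro!: exI[of _ a] exI[of _ "w ` F"] simp: F(1))
  qed
  then have "V.gen_set (w ` F)"
    using V.span_is_subset2[OF sub] by (auto simp: M)
  then have "V.dim = card (w ` F)"
    using li sub by (intro V.dim_basis) (auto simp: V.basis_def F(1))
  then show ?thesis by (simp add: card_image[OF inj])
qed

section \<open>Cycle spaces of finite graphs\<close>

definition flux :: "('a, 'm) ring_scheme \<Rightarrow> 'e set \<Rightarrow> ('e \<Rightarrow> 'v) \<Rightarrow> 'v \<Rightarrow> ('e \<Rightarrow> 'a) \<Rightarrow> 'a" where
  "flux R E \<gamma> v x = (\<Oplus>\<^bsub>R\<^esub>e\<in>{e \<in> E. \<gamma> e = v}. x e)"

text \<open>Kirchhoff's law, imposed at the vertices in \<open>V\<close> only. In the application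
  \<open>V\<close> consists of the regular faces that are not allowed; ends outside \<open>V\<close>
  are allowed faces, or degenerate ones that vanish in the quotient, and neither constrains a
  chain.\<close>

definition balanced ::
    "('a, 'm) ring_scheme \<Rightarrow> 'e set \<Rightarrow> 'v set \<Rightarrow> ('e \<Rightarrow> 'v) \<Rightarrow> ('e \<Rightarrow> 'v) \<Rightarrow> ('e \<Rightarrow> 'a) set" where
  "balanced R E V \<alpha> \<beta> =
    {x \<in> carrier (free_module R E). \<forall>v\<in>V. flux R E \<alpha> v x = flux R E \<beta> v x}"

lemma balanced_swap: "balanced R E V \<alpha> \<beta> = balanced R E V \<beta> \<alpha>"
  by (auto simp: balanced_def)

context cring
begin

lemma flux_closed: "x \<in> E \<rightarrow> carrier R \<Longrightarrow> flux R E \<gamma> v x \<in> carrier R"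
  unfolding flux_def by (intro finsum_closed) auto

lemma flux_cong: "y \<in> E \<rightarrow> carrier R \<Longrightarrow> (\<And>e. e \<in> E \<Longrightarrow> x e = y e) \<Longrightarrow> flux R E \<gamma> v x = flux R E \<gamma> v y"
  unfolding flux_def by (intro finsum_cong') auto

lemma flux_eq_zero: "(\<And>e. e \<in> E \<Longrightarrow> \<gamma> e \<noteq> v) \<Longrightarrow> flux R E \<gamma> v x = \<zero>"
proof -
  assume "\<And>e. e \<in> E \<Longrightarrow> \<gamma> e \<noteq> v"
  then have "{e \<in> E. \<gamma> e = v} = {}" by blast
  then show ?thesis by (simp only: flux_def finsum_empty)
qed

lemma flux_insert:
  assumes "finite E" "e \<notin> E" "x \<in> insert e E \<rightarrow> carrier R"
  shows "flux R (insert e E) \<gamma> v x =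
    (if \<gamma> e = v then x e \<oplus> flux R E \<gamma> v x else flux R E \<gamma> v x)"
proof (cases "\<gamma> e = v")
  case True
  then have "{d \<in> insert e E. \<gamma> d = v} = insert e {d \<in> E. \<gamma> d = v}" by auto
  then show ?thesis using True assms unfolding flux_def
    by (simp add: Pi_iff)
next
  case False
  then have "{d \<in> insert e E. \<gamma> d = v} = {d \<in> E. \<gamma> d = v}" by auto
  then show ?thesis using False unfolding flux_def by simp
qed

lemma flux_merge:
  assumes "finite E" "x \<in> E \<rightarrow> carrier R" "u \<noteq> w" "v \<noteq> u"
  shows "flux R E (\<lambda>d. if \<gamma> d = u then w else \<gamma> d) v x =
    (if v = w then flux R E \<gamma> w x \<oplus> flux R E \<gamma> u x else flux R E \<gamma> v x)"
proof (cases "v = w")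
  case True
  have "{d \<in> E. (if \<gamma> d = u then w else \<gamma> d) = v} = {d \<in> E. \<gamma> d = w} \<union> {d \<in> E. \<gamma> d = u}"
    using True by auto
  then show ?thesis using True assms unfolding flux_def
    by (simp add: Pi_iff, subst finsum_Un_disjoint[symmetric]) (auto simp: Pi_iff)
next
  case False
  then have "{d \<in> E. (if \<gamma> d = u then w else \<gamma> d) = v} = {d \<in> E. \<gamma> d = v}"
    using assms(4) by auto
  then show ?thesis using False unfolding flux_def by simp
qed

lemma free_module_insert:
  assumes "e \<notin> E"
  shows "x \<in> carrier (free_module R (insert e E)) \<longleftrightarrow>
    x e \<in> carrier R \<and> x(e := \<zero>) \<in> carrier (free_module R E)"
proof -
  have "finite {d. (x(e := \<zero>)) d \<noteq> \<zero>} \<longleftrightarrow> finite {d. x d \<noteq> \<zero>}"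
  proof
    assume "finite {d. (x(e := \<zero>)) d \<noteq> \<zero>}"
    then have "finite (insert e {d. (x(e := \<zero>)) d \<noteq> \<zero>})" by simp
    then show "finite {d. x d \<noteq> \<zero>}" by (rule rev_finite_subset) auto
  next
    assume "finite {d. x d \<noteq> \<zero>}"
    then show "finite {d. (x(e := \<zero>)) d \<noteq> \<zero>}" by (rule rev_finite_subset) auto
  qed
  then show ?thesis using assms unfolding free_module_def by auto
qed

text \<open>A loop enters both sides of the same law, and an edge with both ends outside
  \<open>V\<close> enters none, so the value at \<open>e\<close> is unconstrained.\<close>

lemma balanced_insert_free:
  fixes \<alpha> \<beta> :: "'e \<Rightarrow> 'v"
  assumes "finite E" "e \<notin> E" "\<alpha> e = \<beta> e \<or> \<alpha> e \<notin> V \<and> \<beta> e \<notin> V"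
  shows "x \<in> balanced R (insert e E) V \<alpha> \<beta> \<longleftrightarrow>
    x e \<in> carrier R \<and> x(e := \<zero>) \<in> balanced R E V \<alpha> \<beta>"
proof (cases "x \<in> carrier (free_module R (insert e E))")
  case True
  then have x: "x d \<in> carrier R" for d by (rule free_module_closed)
  have c: "flux R E \<gamma> v (x(e := \<zero>)) = flux R E \<gamma> v x" for \<gamma> :: "'e \<Rightarrow> 'v" and v
    using assms(2) x by (intro flux_cong) auto
  have "flux R (insert e E) \<alpha> v x = flux R (insert e E) \<beta> v x \<longleftrightarrow>
      flux R E \<alpha> v x = flux R E \<beta> v x" if "v \<in> V" for v
    using assms that x by (auto simp: flux_insert flux_closed)
  then show ?thesis using True free_module_insert[OF assms(2), of x] by (auto simp: balanced_def c)
next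
  case False
  then show ?thesis using free_module_insert[OF assms(2), of x] by (auto simp: balanced_def)
qed

text \<open>Contracting the edge \<open>e\<close>: the law at \<open>u\<close> determines \<open>x e\<close>, and is added to the law at \<open>w\<close>.\<close>

lemma balanced_insert_contract:
  fixes \<alpha> \<beta> :: "'e \<Rightarrow> 'v"
  assumes "finite E" "e \<notin> E" "\<alpha> e = u" "\<beta> e = w" "u \<noteq> w" "u \<in> V"
  shows "x \<in> balanced R (insert e E) V \<alpha> \<beta> \<longleftrightarrow>
    x(e := \<zero>) \<in> balanced R E (V - {u})
      (\<lambda>d. if \<alpha> d = u then w else \<alpha> d) (\<lambda>d. if \<beta> d = u then w else \<beta> d) \<and>
    x e = flux R E \<beta> u (x(e := \<zero>)) \<ominus> flux R E \<alpha> u (x(e := \<zero>))" (is "_ \<longleftrightarrow> ?R")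
proof (cases "x \<in> carrier (free_module R (insert e E))")
  case True
  then have x: "x d \<in> carrier R" for d by (rule free_module_closed)
  have c: "flux R E \<gamma> v (x(e := \<zero>)) = flux R E \<gamma> v x" for \<gamma> :: "'e \<Rightarrow> 'v" and v
    using assms(2) x by (intro flux_cong) auto
  have m: "flux R E (\<lambda>d. if \<gamma> d = u then w else \<gamma> d) v x =
    (if v = w then flux R E \<gamma> w x \<oplus> flux R E \<gamma> u x else flux R E \<gamma> v x)" if "v \<noteq> u"
    for \<gamma> :: "'e \<Rightarrow> 'v" and v
    using x by (intro flux_merge assms(1,5) that) auto
  have f: "flux R E \<gamma> v x \<in> carrier R" for \<gamma> :: "'e \<Rightarrow> 'v" and v
    by (intro flux_closed) (use x in auto)
  have i: "flux R (insert e E) \<gamma> v x =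
    (if \<gamma> e = v then x e \<oplus> flux R E \<gamma> v x else flux R E \<gamma> v x)" for \<gamma> :: "'e \<Rightarrow> 'v" and v
    using x by (intro flux_insert assms) auto
  have u: "flux R (insert e E) \<alpha> u x = flux R (insert e E) \<beta> u x \<longleftrightarrow>
      x e = flux R E \<beta> u x \<ominus> flux R E \<alpha> u x" 
  proof -
    have "a \<oplus> b = c \<longleftrightarrow> a = c \<ominus> b" if "a \<in> carrier R" "b \<in> carrier R" "c \<in> carrier R" for a b c
      using that by (auto simp: a_minus_def a_assoc l_neg r_neg)
    then show ?thesis using assms(3-5) x f by (simp add: i)
  qed
  have v: "flux R (insert e E) \<alpha> v x = flux R (insert e E) \<beta> v x \<longleftrightarrow>
      flux R E (\<lambda>d. if \<alpha> d = u then w else \<alpha> d) v x = flux R E (\<lambda>d. if \<beta> d = u then w else \<beta> d) v x"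
    if vu: "v \<noteq> u" and e: "x e = flux R E \<beta> u x \<ominus> flux R E \<alpha> u x" for v
  proof (cases "v = w")
    case True
    have "flux R E \<beta> u x = x e \<oplus> flux R E \<alpha> u x"
      using f[of \<alpha> u] f[of \<beta> u] unfolding e by (simp add: a_minus_def a_assoc l_neg)
    then have "flux R E \<beta> w x \<oplus> flux R E \<beta> u x = (x e \<oplus> flux R E \<beta> w x) \<oplus> flux R E \<alpha> u x"
      using x[of e] f by (simp add: a_ac)
    then show ?thesis
      unfolding i m[OF vu] using True assms(3-5) x[of e] f by (simp add: a_assoc[symmetric])
  next
    case False
    then show ?thesis unfolding i m[OF vu] using assms(3-5) vu by simp
  qed
  have "x \<in> balanced R (insert e E) V \<alpha> \<beta> \<longleftrightarrow>
      (\<forall>v\<in>V. flux R (insert e E) \<alpha> v x = flux R (insert e E) \<beta> v x)"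
    using True by (simp add: balanced_def)
  also have "\<dots> \<longleftrightarrow> x e = flux R E \<beta> u x \<ominus> flux R E \<alpha> u x \<and>
      (\<forall>v\<in>V - {u}. flux R (insert e E) \<alpha> v x = flux R (insert e E) \<beta> v x)"
    using assms(6) u by blast
  also have "\<dots> \<longleftrightarrow> ?R"
    using True free_module_insert[OF assms(2), of x] v
    unfolding balanced_def c mem_Collect_eq
    by auto
  finally show ?thesis .
next
  case False
  \<comment> \<open>The right-hand side does not say outright that \<open>x e\<close> lies in the
    ring; this follows because it is a difference of two fluxes.\<close>
  have "x e \<in> carrier R" if ?R
  proof -
    have "x(e := \<zero>) \<in> E \<rightarrow> carrier R"
      using that by (auto simp: balanced_def intro: free_module_closed)
    from flux_closed[OF this, of \<alpha> u] flux_closed[OF this, of \<beta> u] that show ?thesis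
      by simp
  qed
  then show ?thesis
    using False free_module_insert[OF assms(2), of x] by (auto simp: balanced_def)
qed

lemma coordinates_insert_free:
  assumes "finite E" "e \<notin> E" "\<alpha> e = \<beta> e \<or> \<alpha> e \<notin> V \<and> \<beta> e \<notin> V"
    and F: "F \<subseteq> E" "coordinates R (balanced R E V \<alpha> \<beta>) F"
  shows "coordinates R (balanced R (insert e E) V \<alpha> \<beta>) (insert e F)"
  unfolding coordinates_def
proof (intro allI impI)
  note mem = balanced_insert_free[OF assms(1,2), of \<alpha> \<beta> V, OF assms(3)]
  fix z assume z: "\<forall>d\<in>insert e F. z d \<in> carrier R"
  have "\<exists>!x. x \<in> balanced R E V \<alpha> \<beta> \<and> (\<forall>d\<in>F. x d = z d)"
    using F(2) z unfolding coordinates_def by simp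
  then obtain y where "y \<in> balanced R E V \<alpha> \<beta> \<and> (\<forall>d\<in>F. y d = z d)"
    and "\<forall>x. x \<in> balanced R E V \<alpha> \<beta> \<and> (\<forall>d\<in>F. x d = z d) \<longrightarrow> x = y"
    by (rule ex1E)
  then have y: "y \<in> balanced R E V \<alpha> \<beta>" "\<forall>d\<in>F. y d = z d"
    and un: "\<And>x. x \<in> balanced R E V \<alpha> \<beta> \<and> (\<forall>d\<in>F. x d = z d) \<Longrightarrow> x = y"
    by blast+
  have eF: "e \<notin> F" using assms(2) F(1) by auto
  have "y e = \<zero>" using y(1) assms(2) by (auto simp: balanced_def intro: free_module_support(2))
  then have y0: "y(e := \<zero>) = y" by auto
  show "\<exists>!x. x \<in> balanced R (insert e E) V \<alpha> \<beta> \<and> (\<forall>d\<in>insert e F. x d = z d)"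
  proof (rule ex1I[of _ "y(e := z e)"])
    show "y(e := z e) \<in> balanced R (insert e E) V \<alpha> \<beta> \<and> (\<forall>d\<in>insert e F. (y(e := z e)) d = z d)"
      using y z eF by (auto simp: mem y0)
  next
    fix x assume x: "x \<in> balanced R (insert e E) V \<alpha> \<beta> \<and> (\<forall>d\<in>insert e F. x d = z d)"
    then have "x(e := \<zero>) = y"
      using eF by (intro un) (auto simp: mem)
    then show "x = y(e := z e)" using x by (metis fun_upd_triv fun_upd_upd insertI1)
  qed
qed

text \<open>The contracted edge becomes a forest edge: its value is computed from the others, so the
  set of coordinates does not grow.\<close>

lemma coordinates_insert_contract:
  assumes "finite E" "e \<notin> E" "\<alpha> e = u" "\<beta> e = w" "u \<noteq> w" "u \<in> V"
    and F: "F \<subseteq> E" "coordinates R (balanced R E (V - {u})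
      (\<lambda>d. if \<alpha> d = u then w else \<alpha> d) (\<lambda>d. if \<beta> d = u then w else \<beta> d)) F"
  shows "coordinates R (balanced R (insert e E) V \<alpha> \<beta>) F"
  unfolding coordinates_def
proof (intro allI impI)
  let ?B = "balanced R E (V - {u})
      (\<lambda>d. if \<alpha> d = u then w else \<alpha> d) (\<lambda>d. if \<beta> d = u then w else \<beta> d)"
  note mem = balanced_insert_contract[OF assms(1,2), of \<alpha> u \<beta> w V, OF assms(3-6)]
  fix z assume z: "\<forall>d\<in>F. z d \<in> carrier R"
  have "\<exists>!x. x \<in> ?B \<and> (\<forall>d\<in>F. x d = z d)"
    using F(2) z unfolding coordinates_def by simp
  then obtain y where "y \<in> ?B \<and> (\<forall>d\<in>F. y d = z d)"
    and "\<forall>x. x \<in> ?B \<and> (\<forall>d\<in>F. x d = z d) \<longrightarrow> x = y"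
    by (rule ex1E)
  then have y: "y \<in> ?B" "\<forall>d\<in>F. y d = z d"
    and un: "\<And>x. x \<in> ?B \<and> (\<forall>d\<in>F. x d = z d) \<Longrightarrow> x = y"
    by blast+
  have eF: "e \<notin> F" using assms(2) F(1) by auto
  have "y e = \<zero>" using y(1) assms(2) by (auto simp: balanced_def intro: free_module_support(2))
  then have y0: "y(e := \<zero>) = y" by auto
  let ?c = "flux R E \<beta> u y \<ominus> flux R E \<alpha> u y"
  show "\<exists>!x. x \<in> balanced R (insert e E) V \<alpha> \<beta> \<and> (\<forall>d\<in>F. x d = z d)"
  proof (rule ex1I[of _ "y(e := ?c)"])
    show "y(e := ?c) \<in> balanced R (insert e E) V \<alpha> \<beta> \<and> (\<forall>d\<in>F. (y(e := ?c)) d = z d)"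
      using y z eF by (auto simp: mem y0)
  next
    fix x assume x: "x \<in> balanced R (insert e E) V \<alpha> \<beta> \<and> (\<forall>d\<in>F. x d = z d)"
    then have "x(e := \<zero>) = y"
      using eF by (intro un) (auto simp: mem)
    moreover have "x e = flux R E \<beta> u (x(e := \<zero>)) \<ominus> flux R E \<alpha> u (x(e := \<zero>))"
      using x by (simp add: mem)
    ultimately show "x = y(e := ?c)" by (metis fun_upd_triv fun_upd_upd)
  qed
qed

end

lemma coordinates_balanced_empty: "coordinates R (balanced R {} V \<alpha> \<beta>) {}"
proof -
  have "x \<in> balanced R {} V \<alpha> \<beta> \<longleftrightarrow> x = (\<lambda>_. \<zero>\<^bsub>R\<^esub>)" for x
    by (auto simp: balanced_def free_module_def flux_def)
  then show ?thesis unfolding coordinates_def by auto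
qed

text \<open>Whether an edge is declared free or contracted is decided from \<open>V\<close> and its
  two ends alone, so both rings receive the same \<open>F\<close>: the complement of a spanning
  forest of the graph in which all vertices outside \<open>V\<close> are identified. Contraction
  changes the ends and \<open>V\<close>, hence the induction over arbitrary ones.\<close>

lemma common_coordinates_balanced:
  fixes \<alpha> \<beta> :: "'e \<Rightarrow> 'v"
  assumes "cring K" "cring K'" "finite E"
  shows "\<exists>F\<subseteq>E. coordinates K (balanced K E V \<alpha> \<beta>) F \<and> coordinates K' (balanced K' E V \<alpha> \<beta>) F"
  using assms(3)
proof (induction E arbitrary: V \<alpha> \<beta> rule: finite_induct)
  case empty
  show ?case using coordinates_balanced_empty[of K] coordinates_balanced_empty[of K'] by blast
next
  case (insert e E)
  have contract: "\<exists>F\<subseteq>insert e E. coordinates K (balanced K (insert e E) V \<alpha> \<beta>) F \<and>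
      coordinates K' (balanced K' (insert e E) V \<alpha> \<beta>) F"
    if "\<alpha> e \<noteq> \<beta> e" "\<alpha> e \<in> V" for \<alpha> \<beta> :: "'e \<Rightarrow> 'v"
  proof -
    obtain F where "F \<subseteq> E"
      "coordinates K (balanced K E (V - {\<alpha> e}) (\<lambda>d. if \<alpha> d = \<alpha> e then \<beta> e else \<alpha> d)
        (\<lambda>d. if \<beta> d = \<alpha> e then \<beta> e else \<beta> d)) F"
      "coordinates K' (balanced K' E (V - {\<alpha> e}) (\<lambda>d. if \<alpha> d = \<alpha> e then \<beta> e else \<alpha> d)
        (\<lambda>d. if \<beta> d = \<alpha> e then \<beta> e else \<beta> d)) F"
      using insert.IH by blast
    then show ?thesis
      using cring.coordinates_insert_contract[OF assms(1) insert.hyps, of \<alpha> "\<alpha> e" \<beta> "\<beta> e" V, OF refl refl that]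
        cring.coordinates_insert_contract[OF assms(2) insert.hyps, of \<alpha> "\<alpha> e" \<beta> "\<beta> e" V, OF refl refl that] by blast
  qed
  consider "\<alpha> e = \<beta> e \<or> \<alpha> e \<notin> V \<and> \<beta> e \<notin> V" | "\<alpha> e \<noteq> \<beta> e" "\<alpha> e \<in> V" | "\<beta> e \<noteq> \<alpha> e" "\<beta> e \<in> V"
    by metis
  then show ?case
  proof cases
    case 1
    obtain F where "F \<subseteq> E"
      "coordinates K (balanced K E V \<alpha> \<beta>) F" "coordinates K' (balanced K' E V \<alpha> \<beta>) F"
      using insert.IH by blast
    then show ?thesis
      using cring.coordinates_insert_free[OF assms(1) insert.hyps, of \<alpha> \<beta> V, OF 1]
        cring.coordinates_insert_free[OF assms(2) insert.hyps, of \<alpha> \<beta> V, OF 1]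
      by (intro exI[of _ "insert e F"]) auto
  next
    case 2
    then show ?thesis by (rule contract)
  next
    \<comment> \<open>Only the second end lies in \<open>V\<close> for certain; reversing all edges
      exchanges the two sides of every law and reduces this to the contraction of the first
      end.\<close>
    case 3
    then show ?thesis using contract[of \<beta> \<alpha>, OF 3] by (simp add: balanced_swap[of _ _ _ \<beta> \<alpha>])
  qed
qed

section \<open>Path chains of dimension at most 3\<close>

lemma finite_allowed_paths:
  assumes "finite (pverts G)"
  shows "finite (allowed_paths G n)"
proof (rule finite_subset)
  show "allowed_paths G n \<subseteq> {vs. set vs \<subseteq> pverts G \<and> length vs = nat (n + 1)}"
    by (auto simp: allowed_paths_def vertex_seqs_def)
  show "finite {vs. set vs \<subseteq> pverts G \<and> length vs = nat (n + 1)}"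
    by (rule finite_lists_length_eq[OF assms])
qed

lemma (in cring) path_boundary_gen_apply:
  assumes "ws \<in> regular_seqs V (n - 1)"
  shows "path_boundary_gen R V n vs ws =
    (\<Oplus>i\<in>{0..nat n}. if omit_nth i vs = ws then (\<ominus> \<one>) [^] i else \<zero>)"
proof -
  interpret M: Module.module R "path_module R V (n - 1)"
    unfolding path_module_def by (rule module_free_module)
  have "path_boundary_gen R V n vs ws =
    (\<Oplus>i\<in>{0..nat n}. (((\<ominus> \<one>) [^] i) \<odot>\<^bsub>path_module R V (n - 1)\<^esub>
        path_class R V (n - 1) (omit_nth i vs)) ws)"
    unfolding path_boundary_gen_def path_module_def
    by (rule free_module_finsum_apply(2))
       (auto intro!: M.smult_closed[unfolded path_module_def] path_class_closed[unfolded path_module_def])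
  also have "\<dots> = (\<Oplus>i\<in>{0..nat n}. if omit_nth i vs = ws then (\<ominus> \<one>) [^] i else \<zero>)"
    by (intro finsum_cong') (use assms in \<open>auto simp: path_module_def free_module_def path_class_def\<close>)
  finally show ?thesis .
qed

text \<open>Interchanging the two sums groups the paths by their \<open>i\<close>-th face. The
  coefficient of the boundary at \<open>ws\<close> becomes an alternating sum of fluxes in graphs
  whose edges are paths and whose vertices are faces.\<close>

lemma (in cring) finsum_boundary_eq_flux:
  assumes "finite A" "x \<in> A \<rightarrow> carrier R" "ws \<in> regular_seqs V (n - 1)"
  shows "(\<Oplus>p\<in>A. x p \<otimes> path_boundary_gen R V n p ws) =
    (\<Oplus>i\<in>{0..nat n}. (\<ominus> \<one>) [^] i \<otimes> flux R A (omit_nth i) ws x)"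
  using assms(1,2)
proof (induction A rule: finite_induct)
  case empty
  then show ?case by (simp add: flux_def finsum_zero')
next
  case (insert p A)
  then have x: "x q \<in> carrier R" if "q \<in> insert p A" for q using that by blast
  have g: "path_boundary_gen R V n q ws \<in> carrier R" for q
    using path_boundary_gen_closed unfolding path_module_def by (rule free_module_closed)
  have f: "flux R A (omit_nth i) ws x \<in> carrier R" for i
    by (intro flux_closed) (use x in auto)
  have "(\<Oplus>q\<in>insert p A. x q \<otimes> path_boundary_gen R V n q ws) =
      x p \<otimes> path_boundary_gen R V n p ws \<oplus> (\<Oplus>q\<in>A. x q \<otimes> path_boundary_gen R V n q ws)"
    using insert.hyps x g by (intro finsum_insert) auto
  also have "x p \<otimes> path_boundary_gen R V n p ws =
      (\<Oplus>i\<in>{0..nat n}. x p \<otimes> (if omit_nth i p = ws then (\<ominus> \<one>) [^] i else \<zero>))"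
    unfolding path_boundary_gen_apply[OF assms(3)] using x by (intro finsum_rdistr) auto
  also have "(\<Oplus>q\<in>A. x q \<otimes> path_boundary_gen R V n q ws) =
      (\<Oplus>i\<in>{0..nat n}. (\<ominus> \<one>) [^] i \<otimes> flux R A (omit_nth i) ws x)"
    by (rule insert.IH) (use x in auto)
  also have "(\<Oplus>i\<in>{0..nat n}. x p \<otimes> (if omit_nth i p = ws then (\<ominus> \<one>) [^] i else \<zero>)) \<oplus>
      (\<Oplus>i\<in>{0..nat n}. (\<ominus> \<one>) [^] i \<otimes> flux R A (omit_nth i) ws x) =
      (\<Oplus>i\<in>{0..nat n}. x p \<otimes> (if omit_nth i p = ws then (\<ominus> \<one>) [^] i else \<zero>) \<oplus>
        (\<ominus> \<one>) [^] i \<otimes> flux R A (omit_nth i) ws x)"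
    using x f by (intro finsum_addf[symmetric]) auto
  also have "\<dots> = (\<Oplus>i\<in>{0..nat n}. (\<ominus> \<one>) [^] i \<otimes> flux R (insert p A) (omit_nth i) ws x)"
    using x f insert.prems
    by (intro finsum_cong') (auto simp: flux_insert insert.hyps r_distr m_comm)
  finally show ?case .
qed

lemma (in cring) path_boundary_closed:
  assumes "x \<in> carrier (free_module R S)"
  shows "path_boundary R V n x \<in> carrier (path_module R V (n - 1))"
proof -
  interpret M: Module.module R "path_module R V (n - 1)"
    unfolding path_module_def by (rule module_free_module)
  show ?thesis unfolding path_boundary_def
    using free_module_closed[OF assms] by (intro M.finsum_closed) (auto intro!: path_boundary_gen_closed)
qed

text \<open>The boundary is defined by a sum over the support of \<open>x\<close>, which varies with
  \<open>x\<close>; finiteness of the digraph allows a sum over the fixed set of all allowed paths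
  instead.\<close>

lemma (in cring) carrier_path_chains:
  assumes "finite (pverts G)"
  shows "carrier (path_chains R G n) = {x \<in> carrier (free_module R (allowed_paths G n)).
    \<forall>ws\<in>regular_seqs (pverts G) (n - 1) - allowed_paths G (n - 1).
      (\<Oplus>p\<in>allowed_paths G n. x p \<otimes> path_boundary_gen R (pverts G) n p ws) = \<zero>}"
proof -
  let ?A = "allowed_paths G" and ?V = "pverts G"
  have "path_boundary R ?V n x \<in> carrier (free_module R (?A (n - 1))) \<longleftrightarrow>
    (\<forall>ws\<in>regular_seqs ?V (n - 1) - ?A (n - 1).
      (\<Oplus>p\<in>?A n. x p \<otimes> path_boundary_gen R ?V n p ws) = \<zero>)"
    if x: "x \<in> carrier (free_module R (?A n))" for x
  proof -
    have b: "path_boundary R ?V n x ws = (\<Oplus>p\<in>?A n. x p \<otimes> path_boundary_gen R ?V n p ws)" for ws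
      using free_module_support(2)[OF x]
      by (intro path_boundary_apply[OF x finite_allowed_paths[OF assms]]) auto
    have c: "path_boundary R ?V n x \<in> carrier (free_module R (regular_seqs ?V (n - 1)))"
      using path_boundary_closed[OF x] by (simp add: path_module_def)
    have "path_boundary R ?V n x \<in> carrier (free_module R (?A (n - 1))) \<longleftrightarrow>
        (\<forall>ws. ws \<notin> ?A (n - 1) \<longrightarrow> path_boundary R ?V n x ws = \<zero>)"
      using free_module_support(1)[OF c] free_module_closed[OF c]
      by (auto simp: free_module_def)
    then show ?thesis using free_module_support(2)[OF c] unfolding b by blast
  qed
  then show ?thesis by (auto simp: path_chains_def allowed_chains_def)
qed

lemma dim_path_chains:
  assumes "field K" "pair_digraph G" "finite F" "coordinates K (carrier (path_chains K G n)) F"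
  shows "vectorspace.dim K (path_chains K G n) = card F"
proof -
  interpret G: pair_digraph G by fact
  interpret K: field K by fact
  have lf: "pair_loopfree_digraph G" ..
  have eq: "path_chains K G n = free_module K (regular_seqs (pverts G) n)
      \<lparr>carrier := carrier (path_chains K G n)\<rparr>"
    by (simp add: path_chains_def path_module_def)
  have "carrier (path_chains K G n) \<subseteq> carrier (free_module K (regular_seqs (pverts G) n))"
    using LinearCombinations.submodule.subset[OF K.submodule_path_chains[OF lf]]
    by (simp add: path_module_def)
  then show ?thesis
    using dim_eq_card_coordinates[OF assms(1) _ _ assms(3,4), of "regular_seqs (pverts G) n"]
      vectorspace_path_chains[OF assms(1) lf, of n] eq
    by simp
qed

text \<open>The two end faces never obstruct a chain, so only the interior faces remain to be
  examined.\<close>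

lemma omit_nth_allowed:
  assumes "p \<in> allowed_paths G n" "n \<ge> 1"
  shows "omit_nth 0 p \<in> allowed_paths G (n - 1)" "omit_nth (nat n) p \<in> allowed_paths G (n - 1)"
proof -
  have l: "length p = Suc (nat n)" and V: "set p \<subseteq> pverts G"
    and s: "successively (\<lambda>u v. (u, v) \<in> parcs G) p"
    using assms by (auto simp: allowed_paths_def vertex_seqs_def)
  from l obtain v q where p: "p = v # q" by (cases p) auto
  then show "omit_nth 0 p \<in> allowed_paths G (n - 1)"
    using l V s assms(2) by (auto simp: omit_nth_def allowed_paths_def vertex_seqs_def successively_Cons)
  from l obtain w q where "p = q @ [w]" by (cases p rule: rev_cases) auto
  then show "omit_nth (nat n) p \<in> allowed_paths G (n - 1)"
    using l V s assms(2) by (auto simp: omit_nth_def allowed_paths_def vertex_seqs_def successively_append_iff)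
qed

text \<open>
  A path of length at most 3 has at most two interior faces, and they carry opposite signs, so
  the chain condition is Kirchhoff's law on the graph whose edges are the allowed paths and
  whose vertices are the faces.
\<close>

lemma (in cring) path_chains_eq_balanced:
  assumes "pair_digraph G" "n \<le> 3"
  shows "carrier (path_chains R G n) =
    balanced R (allowed_paths G n) (regular_seqs (pverts G) (n - 1) - allowed_paths G (n - 1))
      (omit_nth 2) (omit_nth 1)"
proof -
  interpret G: pair_digraph G by fact
  let ?A = "allowed_paths G" and ?V = "pverts G"
  have fin: "finite (?A n)" by (rule finite_allowed_paths) simp
  have "(\<Oplus>p\<in>?A n. x p \<otimes> path_boundary_gen R ?V n p ws) = \<zero> \<longleftrightarrow>
      flux R (?A n) (omit_nth 2) ws x = flux R (?A n) (omit_nth 1) ws x"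
    if x: "x \<in> carrier (free_module R (?A n))"
      and ws: "ws \<in> regular_seqs ?V (n - 1)" "ws \<notin> ?A (n - 1)" for x ws
  proof -
    have xc: "x \<in> ?A n \<rightarrow> carrier R" using free_module_closed[OF x] by simp
    have f: "flux R (?A n) (omit_nth i) ws x \<in> carrier R" for i
      by (rule flux_closed[OF xc])
    \<comment> \<open>For smaller \<open>n\<close> there is no sequence of dimension
      \<open>n - 1\<close>, and for \<open>n = 1\<close> every such sequence is a single vertex and
      therefore allowed.\<close>
    have "n \<ge> 1" using ws(1) by (cases ws) (auto simp: regular_seqs_def vertex_seqs_def)
    then have outer: "flux R (?A n) (omit_nth 0) ws x = \<zero>" "flux R (?A n) (omit_nth (nat n)) ws x = \<zero>"
      using ws(2) omit_nth_allowed[of _ G n] by (metis flux_eq_zero)+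
    have "n \<noteq> 1"
      using ws by (auto simp: regular_seqs_def vertex_seqs_def allowed_paths_def length_Suc_conv)
    then consider "n = 2" | "n = 3" using assms(2) \<open>n \<ge> 1\<close> by linarith
    then show ?thesis
    proof cases
      case 1
      \<comment> \<open>In dimension 2, \<open>omit_nth 2\<close> removes the last vertex; its flux
        at \<open>ws\<close> already vanishes, so the balance law says that the flux of the only
        interior face is zero.\<close>
      then show ?thesis
        using outer f unfolding finsum_boundary_eq_flux[OF fin xc ws(1)]
        by (auto simp: numeral_2_eq_2 atLeast0_atMost_Suc l_minus)
    next
      case 2
      have "\<ominus> a \<oplus> b = \<zero> \<longleftrightarrow> b = a" if "a \<in> carrier R" "b \<in> carrier R" for a b
        using that by (metis a_comm a_inv_closed a_minus_def r_right_minus_eq)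
      with 2 show ?thesis
        using outer f unfolding finsum_boundary_eq_flux[OF fin xc ws(1)]
        by (simp add: numeral_2_eq_2 numeral_3_eq_3 atLeast0_atMost_Suc l_minus a_comm)
    qed
  qed
  then show ?thesis
    unfolding carrier_path_chains[OF G.pair_finite_verts] balanced_def by auto
qed

lemma dim_path_chains_field_independent:
  assumes "field K" "field K'" "pair_digraph G" "n \<le> 3"
  shows "vectorspace.dim K (path_chains K G n) = vectorspace.dim K' (path_chains K' G n)"
proof -
  interpret G: pair_digraph G by fact
  have c: "cring K" "cring K'" using assms(1,2) by (simp_all add: field_def domain_def)
  have fin: "finite (allowed_paths G n)" by (rule finite_allowed_paths) simp
  obtain F where F: "F \<subseteq> allowed_paths G n" "coordinates K (carrier (path_chains K G n)) F"
    "coordinates K' (carrier (path_chains K' G n)) F"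
    unfolding cring.path_chains_eq_balanced[OF c(1) assms(3,4)]
      cring.path_chains_eq_balanced[OF c(2) assms(3,4)]
    using common_coordinates_balanced[OF c fin] by blast
  have "finite F" using F(1) fin by (rule finite_subset)
  then show ?thesis
    using dim_path_chains[OF assms(1,3) _ F(2)] dim_path_chains[OF assms(2,3) _ F(3)] by simp
qed

lemma dim_path_chains_no_paths:
  assumes "field K" "pair_digraph G" "allowed_paths G n = {}"
  shows "vectorspace.dim K (path_chains K G n) = 0"
proof -
  interpret G: pair_digraph G by fact
  interpret K: field K by fact
  have "x \<in> carrier (path_chains K G n) \<longleftrightarrow> x = (\<lambda>_. \<zero>\<^bsub>K\<^esub>)" for x
    unfolding K.carrier_path_chains[OF G.pair_finite_verts] using assms(3)
    by (auto simp: free_module_def)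
  then have "coordinates K (carrier (path_chains K G n)) {}"
    unfolding coordinates_def by auto
  from dim_path_chains[OF assms(1,2) _ this] show ?thesis by simp
qed

section \<open>A square complex for the Moore space\<close>

text \<open>
  The 4-cycle \<open>c\<^sub>0 c\<^sub>1 c\<^sub>2 c\<^sub>3\<close> is the rim; the disc has an inner polygon
  \<open>q\<^sub>0 \<dots> q\<^sub>2\<^sub>m\<^sub>-\<^sub>1\<close>, an annulus of squares \<open>c\<^sub>i q\<^sub>i q\<^sub>i\<^sub>+\<^sub>1 c\<^sub>i\<^sub>+\<^sub>1\<close> (\<open>SqA j\<close> for \<open>i = 2j\<close>,
  \<open>SqB j\<close> for \<open>i = 2j + 1\<close>) and squares \<open>Fan j\<close> joining \<open>q\<^sub>2\<^sub>j q\<^sub>2\<^sub>j\<^sub>+\<^sub>1 q\<^sub>2\<^sub>j\<^sub>+\<^sub>2\<close> to the hub. Here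
  \<open>Rim1 (even j)\<close>, \<open>Rim3 (even j)\<close>, \<open>Poly3 j\<close>, \<open>Poly1 j\<close> are \<open>c\<^sub>2\<^sub>j\<close>, \<open>c\<^sub>2\<^sub>j\<^sub>+\<^sub>1\<close>, \<open>q\<^sub>2\<^sub>j\<close>, \<open>q\<^sub>2\<^sub>j\<^sub>+\<^sub>1\<close>, the
  numeral being the layer. The boundary winds \<open>m div 2\<close> times around the rim.
\<close>

datatype vertex =
    Source | Sink
  | Rim1 bool | Hub | Poly1 nat
  | SqA nat | SqB nat | Fan nat
  | Rim3 bool | Poly3 nat

instance vertex :: countable by countable_datatype

text \<open>Opposite corners of a square lie in the same layer: one pair becomes the in-neighbours
  of the cell, the other its out-neighbours. The paths from source to sink through a cell are thus
  the four sides of its square. Indices from \<open>m\<close> on give cells without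
  neighbours.\<close>

fun cell_in :: "nat \<Rightarrow> vertex \<Rightarrow> vertex set" where
  "cell_in m (SqA j) = (if j < m then {Rim1 (even j), Poly1 j} else {})"
| "cell_in m (SqB j) = (if j < m then {Rim1 (odd j), Poly1 j} else {})"
| "cell_in m (Fan j) = (if j < m then {Hub, Poly1 j} else {})"
| "cell_in m _ = {}"

fun cell_out :: "nat \<Rightarrow> vertex \<Rightarrow> vertex set" where
  "cell_out m (SqA j) = (if j < m then {Poly3 j, Rim3 (even j)} else {})"
| "cell_out m (SqB j) = (if j < m then {Poly3 (Suc j mod m), Rim3 (even j)} else {})"
| "cell_out m (Fan j) = (if j < m then {Poly3 j, Poly3 (Suc j mod m)} else {})"
| "cell_out m _ = {}"

definition cells :: "nat \<Rightarrow> vertex set" where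
  "cells m = SqA ` {..<m} \<union> SqB ` {..<m} \<union> Fan ` {..<m}"

definition cell_arcs :: "nat \<Rightarrow> (vertex \<times> vertex) set" where
  "cell_arcs m = (\<Union>s\<in>cells m. (\<Union>u\<in>cell_in m s. {(Source, u), (u, s)}) \<union>
    (\<Union>v\<in>cell_out m s. {(s, v), (v, Sink)}))"

text \<open>Taking only ends of arcs as vertices keeps the vertex set finite although the datatype
  is infinite. The encoding into the naturals fixes one vertex type for all
  \<open>t\<close>.\<close>

definition moore_digraph :: "nat \<Rightarrow> nat pair_pre_digraph" where
  "moore_digraph m = \<lparr> pverts = to_nat ` (fst ` cell_arcs m \<union> snd ` cell_arcs m),
    parcs = map_prod to_nat to_nat ` cell_arcs m \<rparr>"

fun level :: "vertex \<Rightarrow> nat" where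
  "level Source = 0"
| "level (Rim1 _) = 1" | "level Hub = 1" | "level (Poly1 _) = 1"
| "level (SqA _) = 2" | "level (SqB _) = 2" | "level (Fan _) = 2"
| "level (Rim3 _) = 3" | "level (Poly3 _) = 3"
| "level Sink = 4"

lemma finite_cell_in: "finite (cell_in m s)" and finite_cell_out: "finite (cell_out m s)"
  by (cases s; simp)+

lemma cell_in_level: "u \<in> cell_in m s \<Longrightarrow> level u = 1 \<and> level s = 2"
  and cell_out_level: "v \<in> cell_out m s \<Longrightarrow> level v = 3 \<and> level s = 2"
  by (cases s; auto split: if_splits)+

lemma cell_in_cells: "u \<in> cell_in m s \<Longrightarrow> s \<in> cells m"
  and cell_out_cells: "v \<in> cell_out m s \<Longrightarrow> s \<in> cells m"
  by (cases s; auto simp: cells_def split: if_splits)+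

lemma cell_arcs_iff: "(x, y) \<in> cell_arcs m \<longleftrightarrow>
    x = Source \<and> (\<exists>s. y \<in> cell_in m s) \<or> x \<in> cell_in m y \<or> y \<in> cell_out m x \<or>
    (\<exists>s. x \<in> cell_out m s) \<and> y = Sink"
  unfolding cell_arcs_def using cell_in_cells cell_out_cells by fastforce

lemma finite_cell_arcs: "finite (cell_arcs m)"
  unfolding cell_arcs_def cells_def by (auto simp: finite_cell_in finite_cell_out)

lemma cell_arcs_level: "(x, y) \<in> cell_arcs m \<Longrightarrow> level y = Suc (level x)"
  by (auto simp: cell_arcs_iff dest: cell_in_level cell_out_level)

section \<open>Allowed paths of the layered digraph\<close>

lemma moore_arc_iff [simp]:
  "(to_nat x, to_nat y) \<in> parcs (moore_digraph m) \<longleftrightarrow> (x, y) \<in> cell_arcs m"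
  by (auto simp: moore_digraph_def)

lemma pair_digraph_moore: "pair_digraph (moore_digraph m)"
proof
  fix e assume e: "e \<in> parcs (moore_digraph m)"
  then show "fst e \<in> pverts (moore_digraph m)" "snd e \<in> pverts (moore_digraph m)"
    by (force simp: moore_digraph_def)+
  show "fst e \<noteq> snd e"
    using e by (auto simp: moore_digraph_def dest: cell_arcs_level)
next
  show "finite (pverts (moore_digraph m))" "finite (parcs (moore_digraph m))"
    by (simp_all add: moore_digraph_def finite_cell_arcs)
qed

lemma vertex_seqs_moore:
  "ws \<in> vertex_seqs (pverts (moore_digraph m)) n \<longleftrightarrow>
    (\<exists>p. ws = map to_nat p \<and> p \<noteq> [] \<and> int (length p) = n + 1 \<and>
      set p \<subseteq> fst ` cell_arcs m \<union> snd ` cell_arcs m)"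
proof
  assume ws: "ws \<in> vertex_seqs (pverts (moore_digraph m)) n"
  define p :: "vertex list" where "p = map from_nat ws"
  have ex: "\<exists>x\<in>fst ` cell_arcs m \<union> snd ` cell_arcs m. w = to_nat x" if "w \<in> set ws" for w
    using subsetD[OF _ that, of "pverts (moore_digraph m)"] ws
    by (auto simp: vertex_seqs_def moore_digraph_def)
  have w: "to_nat (from_nat w :: vertex) = w \<and>
      (from_nat w :: vertex) \<in> fst ` cell_arcs m \<union> snd ` cell_arcs m" if "w \<in> set ws" for w
    using ex[OF that] by (metis from_nat_to_nat)
  have "ws = map to_nat p"
    using w by (simp add: p_def map_idI)
  moreover have "set p \<subseteq> fst ` cell_arcs m \<union> snd ` cell_arcs m"
    using w unfolding p_def set_map by blast
  ultimately show "\<exists>p. ws = map to_nat p \<and> p \<noteq> [] \<and> int (length p) = n + 1 \<and>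
      set p \<subseteq> fst ` cell_arcs m \<union> snd ` cell_arcs m"
    using ws by (auto simp: vertex_seqs_def)
next
  assume "\<exists>p. ws = map to_nat p \<and> p \<noteq> [] \<and> int (length p) = n + 1 \<and>
      set p \<subseteq> fst ` cell_arcs m \<union> snd ` cell_arcs m"
  then obtain p where p: "ws = map to_nat p" "p \<noteq> []" "int (length p) = n + 1"
    and "set p \<subseteq> fst ` cell_arcs m \<union> snd ` cell_arcs m" by blast
  from image_mono[OF this(4), of to_nat] p show "ws \<in> vertex_seqs (pverts (moore_digraph m)) n"
    by (simp add: vertex_seqs_def moore_digraph_def)
qed

lemma successively_cell_arcs_verts:
  assumes "successively (\<lambda>x y. (x, y) \<in> cell_arcs m) p" "length p \<ge> 2"
  shows "set p \<subseteq> fst ` cell_arcs m \<union> snd ` cell_arcs m"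
  using assms
proof (induction p)
  case (Cons x p)
  then obtain y q where p: "p = y # q" by (cases p) auto
  have xy: "(x, y) \<in> cell_arcs m" using Cons.prems p by simp
  then have "x \<in> fst ` cell_arcs m" "y \<in> snd ` cell_arcs m" by force+
  moreover have "q = [] \<or> set p \<subseteq> fst ` cell_arcs m \<union> snd ` cell_arcs m"
    using Cons.IH Cons.prems p by (cases q) auto
  ultimately show ?case using p by auto
qed simp

lemma allowed_paths_moore:
  assumes "n \<ge> 1"
  shows "allowed_paths (moore_digraph m) n = map to_nat `
    {p. int (length p) = n + 1 \<and> successively (\<lambda>x y. (x, y) \<in> cell_arcs m) p}"
proof -
  have "ws \<in> allowed_paths (moore_digraph m) n \<longleftrightarrow>
    (\<exists>p. ws = map to_nat p \<and> int (length p) = n + 1 \<and> successively (\<lambda>x y. (x, y) \<in> cell_arcs m) p)" for ws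
  proof
    assume "ws \<in> allowed_paths (moore_digraph m) n"
    then show "\<exists>p. ws = map to_nat p \<and> int (length p) = n + 1 \<and> successively (\<lambda>x y. (x, y) \<in> cell_arcs m) p"
      unfolding allowed_paths_def vertex_seqs_moore by (auto simp: successively_map)
  next
    assume "\<exists>p. ws = map to_nat p \<and> int (length p) = n + 1 \<and> successively (\<lambda>x y. (x, y) \<in> cell_arcs m) p"
    then obtain p where p: "ws = map to_nat p" "int (length p) = n + 1"
      "successively (\<lambda>x y. (x, y) \<in> cell_arcs m) p" by blast
    moreover have "set p \<subseteq> fst ` cell_arcs m \<union> snd ` cell_arcs m"
      using p(2) assms by (intro successively_cell_arcs_verts p(3)) simp
    moreover have "p \<noteq> []" using p(2) assms by auto
    ultimately show "ws \<in> allowed_paths (moore_digraph m) n"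
      unfolding allowed_paths_def mem_Collect_eq vertex_seqs_moore by (auto simp: successively_map)
  qed
  then show ?thesis by blast
qed

definition cell_path :: "vertex \<Rightarrow> vertex \<Rightarrow> vertex \<Rightarrow> nat list" where
  "cell_path u s v = map to_nat [Source, u, s, v, Sink]"

lemma successively_level:
  assumes "successively (\<lambda>x y. (x, y) \<in> cell_arcs m) p" "i < length p"
  shows "level (p ! i) = level (p ! 0) + i"
  using assms(2)
proof (induction i)
  case (Suc i)
  then show ?case using cell_arcs_level[OF successively_nth[OF assms(1)]] by simp
qed simp

lemma level_le_4: "level x \<le> 4"
  by (cases x) auto

lemma allowed_paths_moore_ge_5: "n \<ge> 5 \<Longrightarrow> allowed_paths (moore_digraph m) n = {}"
proof -
  assume n: "n \<ge> 5"
  have False if p: "int (length p) = n + 1" "successively (\<lambda>x y. (x, y) \<in> cell_arcs m) p" for p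
    using successively_level[OF p(2), of 5] level_le_4[of "p ! 5"] p(1) n by simp
  then show ?thesis using n by (auto simp: allowed_paths_moore)
qed

lemma allowed_paths_moore_4:
  "allowed_paths (moore_digraph m) 4 =
    {cell_path u s v | u s v. u \<in> cell_in m s \<and> v \<in> cell_out m s}"
proof -
  have "int (length p) = 5 \<and> successively (\<lambda>x y. (x, y) \<in> cell_arcs m) p \<longleftrightarrow>
      (\<exists>u s v. p = [Source, u, s, v, Sink] \<and> u \<in> cell_in m s \<and> v \<in> cell_out m s)" for p
  proof
    assume p: "int (length p) = 5 \<and> successively (\<lambda>x y. (x, y) \<in> cell_arcs m) p"
    then obtain a u s v b where ab: "p = [a, u, s, v, b]"
      by (auto simp: length_Suc_conv numeral_eq_Suc)
    with p have arcs: "(a, u) \<in> cell_arcs m" "(u, s) \<in> cell_arcs m" "(s, v) \<in> cell_arcs m" "(v, b) \<in> cell_arcs m"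
      by simp_all
    note l = arcs[THEN cell_arcs_level]
    \<comment> \<open>Four arcs raise the level by four, which is the maximum, so the path runs from
      the bottom layer to the top one.\<close>
    have "level a = 0" using l level_le_4[of b] by simp
    then have a: "a = Source" and b: "b = Sink" using l
      by (cases a; cases b; simp)+
    have "u \<in> cell_in m s" "v \<in> cell_out m s"
      using arcs(2,3) l a unfolding cell_arcs_iff by (auto dest: cell_in_level cell_out_level)
    then show "\<exists>u s v. p = [Source, u, s, v, Sink] \<and> u \<in> cell_in m s \<and> v \<in> cell_out m s"
      using ab a b by simp
  qed (auto simp: cell_arcs_iff)
  then have "{p. int (length p) = 5 \<and> successively (\<lambda>x y. (x, y) \<in> cell_arcs m) p} =
      {[Source, u, s, v, Sink] | u s v. u \<in> cell_in m s \<and> v \<in> cell_out m s}"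
    by blast
  then have "allowed_paths (moore_digraph m) 4 =
      map to_nat ` {[Source, u, s, v, Sink] | u s v. u \<in> cell_in m s \<and> v \<in> cell_out m s}"
    by (simp add: allowed_paths_moore)
  then show ?thesis unfolding cell_path_def by blast
qed

lemma cell_path_eq_iff [simp]: "cell_path u s v = cell_path u' s' v' \<longleftrightarrow> u = u' \<and> s = s' \<and> v = v'"
  by (simp add: cell_path_def)

lemma omit_nth_cell_path:
  "omit_nth 1 (cell_path u s v) = map to_nat [Source, s, v, Sink]"
  "omit_nth 2 (cell_path u s v) = map to_nat [Source, u, v, Sink]"
  "omit_nth 3 (cell_path u s v) = map to_nat [Source, u, s, Sink]"
  by (simp_all add: omit_nth_def cell_path_def numeral_2_eq_2 numeral_3_eq_3)

text \<open>The three interior faces of a path lack the levels 1, 2 and 3 respectively. No sequence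
  is an interior face of two kinds, so in the alternating sum at a given sequence at most one flux
  is nonzero, and the chain condition splits into three. Sequences that are not faces have flux
  zero, which allows quantifying over all \<open>ws\<close>.\<close>

lemma (in cring) path_chains_moore_4:
  "x \<in> carrier (path_chains R (moore_digraph m) 4) \<longleftrightarrow>
    x \<in> carrier (free_module R (allowed_paths (moore_digraph m) 4)) \<and>
    (\<forall>i\<in>{1, 2, 3}. \<forall>ws. flux R (allowed_paths (moore_digraph m) 4) (omit_nth i) ws x = \<zero>)"
proof -
  let ?G = "moore_digraph m"
  let ?P = "allowed_paths ?G"
  interpret G: pair_digraph ?G by (rule pair_digraph_moore)
  have "(\<forall>ws\<in>regular_seqs (pverts ?G) 3 - ?P 3.
      (\<Oplus>p\<in>?P 4. x p \<otimes> path_boundary_gen R (pverts ?G) 4 p ws) = \<zero>) \<longleftrightarrow>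
    (\<forall>i\<in>{1, 2, 3}. \<forall>ws. flux R (?P 4) (omit_nth i) ws x = \<zero>)" (is "?L \<longleftrightarrow> ?R")
    if x: "x \<in> carrier (free_module R (?P 4))"
  proof -
    have fin: "finite (?P 4)" by (rule finite_allowed_paths[OF G.pair_finite_verts])
    have xc: "x \<in> ?P 4 \<rightarrow> carrier R" using free_module_closed[OF x] by simp
    have f: "flux R (?P 4) (omit_nth i) ws x \<in> carrier R" for i ws
      by (rule flux_closed[OF xc])
    have sum: "(\<Oplus>p\<in>?P 4. x p \<otimes> path_boundary_gen R (pverts ?G) 4 p ws) =
        \<ominus> flux R (?P 4) (omit_nth 1) ws x \<oplus> flux R (?P 4) (omit_nth 2) ws x \<ominus> flux R (?P 4) (omit_nth 3) ws x"
      if ws: "ws \<in> regular_seqs (pverts ?G) 3" "ws \<notin> ?P 3" for ws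
    proof -
      have "flux R (?P 4) (omit_nth 0) ws x = \<zero>" "flux R (?P 4) (omit_nth 4) ws x = \<zero>"
        using ws(2) omit_nth_allowed[of _ ?G 4] by (intro flux_eq_zero; force)+
      then show ?thesis
        using finsum_boundary_eq_flux[OF fin xc, of ws "pverts ?G" 4] ws(1) f
        by (simp add: eval_nat_numeral atLeast0_atMost_Suc l_minus a_minus_def a_ac)
    qed
    show ?thesis
    proof
      assume R: ?R
      have "flux R (?P 4) (omit_nth 1) ws x = \<zero>" "flux R (?P 4) (omit_nth 2) ws x = \<zero>" 
        "flux R (?P 4) (omit_nth 3) ws x = \<zero>" for ws
        using R by blast+
      then show ?L using sum by (simp add: a_minus_def)
    next
      assume L: ?L
      show ?R
      proof (intro ballI allI)
        fix i :: nat and ws assume i: "i \<in> {1, 2, 3}"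
        show "flux R (?P 4) (omit_nth i) ws x = \<zero>"
        proof (cases "\<exists>p\<in>?P 4. omit_nth i p = ws")
          case False
          then show ?thesis by (intro flux_eq_zero) blast
        next
          case True
          then obtain u s v where usv: "u \<in> cell_in m s" "v \<in> cell_out m s"
            and ws: "ws = omit_nth i (cell_path u s v)"
            by (auto simp: allowed_paths_moore_4)
          note lev = cell_in_level[OF usv(1)] cell_out_level[OF usv(2)]
          \<comment> \<open>The levels occurring in \<open>ws\<close> reveal which entry was
            omitted.\<close>
          have other: "flux R (?P 4) (omit_nth j) ws x = \<zero>" if "j \<in> {1, 2, 3}" "j \<noteq> i" for j
            using that i ws lev omit_nth_cell_path
            by (intro flux_eq_zero) (auto simp: allowed_paths_moore_4 dest: cell_in_level cell_out_level)
          have arcs: "(Source, u) \<in> cell_arcs m" "(u, s) \<in> cell_arcs m" "(s, v) \<in> cell_arcs m" "(v, Sink) \<in> cell_arcs m"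
            using usv by (auto simp: cell_arcs_iff)
          have V: "{Source, u, s, v, Sink} \<subseteq> fst ` cell_arcs m \<union> snd ` cell_arcs m"
            using arcs by force
          \<comment> \<open>Consecutive levels differ, so the face is regular; across the gap the
            level jumps by two, so the face is not allowed and the chain condition applies to
            it.\<close>
          obtain q where q: "ws = map to_nat q" "length q = 4" "set q \<subseteq> {Source, u, s, v, Sink}"
            "successively (\<noteq>) q" "\<not> successively (\<lambda>x y. (x, y) \<in> cell_arcs m) q"
          proof -
            consider "i = 1" | "i = 2" | "i = 3" using i by auto
            then show thesis
            proof cases
              case 1
              show thesis
                by (rule that[of "[Source, s, v, Sink]"])
                   (use lev ws 1 omit_nth_cell_path in \<open>auto dest: cell_arcs_level\<close>)
            next
              case 2
              show thesis
                by (rule that[of "[Source, u, v, Sink]"])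
                   (use lev ws 2 omit_nth_cell_path in \<open>auto dest: cell_arcs_level\<close>)
            next
              case 3
              show thesis
                by (rule that[of "[Source, u, s, Sink]"])
                   (use lev ws 3 omit_nth_cell_path in \<open>auto dest: cell_arcs_level\<close>)
            qed
          qed
          have "q \<noteq> []" using q(2) by auto
          then have "ws \<in> regular_seqs (pverts ?G) 3"
            unfolding regular_seqs_def mem_Collect_eq vertex_seqs_moore
            using q(1,2,4) subset_trans[OF q(3) V] by (auto simp: successively_map)
          moreover have "ws \<notin> ?P 3"
            using q(1,5) inj_map_eq_map[OF inj_to_nat] by (auto simp: allowed_paths_moore)
          ultimately have "\<ominus> flux R (?P 4) (omit_nth 1) ws x \<oplus> flux R (?P 4) (omit_nth 2) ws x \<ominus> flux R (?P 4) (omit_nth 3) ws x = \<zero>"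
            using L sum by simp
          then show ?thesis using i other f by (auto simp: a_minus_def)
        qed
      qed
    qed
  qed
  then show ?thesis unfolding carrier_path_chains[OF G.pair_finite_verts] by auto
qed

section \<open>Path chains of dimension 4\<close>

context cring
begin

lemma flux_cell_path:
  fixes x :: "nat list \<Rightarrow> 'a"
  assumes x: "\<And>p. x p \<in> carrier R"
  shows "v \<in> cell_out m s \<Longrightarrow>
      flux R (allowed_paths (moore_digraph m) 4) (omit_nth 1) (map to_nat [Source, s, v, Sink]) x =
      (\<Oplus>u\<in>cell_in m s. x (cell_path u s v))"
    and "flux R (allowed_paths (moore_digraph m) 4) (omit_nth 2) (map to_nat [Source, u, v, Sink]) x =
      (\<Oplus>s\<in>{s. u \<in> cell_in m s \<and> v \<in> cell_out m s}. x (cell_path u s v))"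
    and "u \<in> cell_in m s \<Longrightarrow>
      flux R (allowed_paths (moore_digraph m) 4) (omit_nth 3) (map to_nat [Source, u, s, Sink]) x =
      (\<Oplus>v\<in>cell_out m s. x (cell_path u s v))"
proof -
  let ?P = "allowed_paths (moore_digraph m) 4"
  assume "v \<in> cell_out m s"
  then have "{p \<in> ?P. omit_nth 1 p = map to_nat [Source, s, v, Sink]} = (\<lambda>u. cell_path u s v) ` cell_in m s"
    by (auto simp: allowed_paths_moore_4 omit_nth_cell_path[unfolded One_nat_def])
  then show "flux R ?P (omit_nth 1) (map to_nat [Source, s, v, Sink]) x =
      (\<Oplus>u\<in>cell_in m s. x (cell_path u s v))"
    unfolding flux_def by (simp only:) (rule finsum_reindex; auto simp: x inj_on_def)
next
  let ?P = "allowed_paths (moore_digraph m) 4"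
  have "{p \<in> ?P. omit_nth 2 p = map to_nat [Source, u, v, Sink]} =
      (\<lambda>s. cell_path u s v) ` {s. u \<in> cell_in m s \<and> v \<in> cell_out m s}"
    by (auto simp: allowed_paths_moore_4 omit_nth_cell_path)
  then show "flux R ?P (omit_nth 2) (map to_nat [Source, u, v, Sink]) x =
      (\<Oplus>s\<in>{s. u \<in> cell_in m s \<and> v \<in> cell_out m s}. x (cell_path u s v))"
    unfolding flux_def by (simp only:) (rule finsum_reindex; auto simp: x inj_on_def)
next
  let ?P = "allowed_paths (moore_digraph m) 4"
  assume "u \<in> cell_in m s"
  then have "{p \<in> ?P. omit_nth 3 p = map to_nat [Source, u, s, Sink]} = (\<lambda>v. cell_path u s v) ` cell_out m s"
    by (auto simp: allowed_paths_moore_4 omit_nth_cell_path)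
  then show "flux R ?P (omit_nth 3) (map to_nat [Source, u, s, Sink]) x =
      (\<Oplus>v\<in>cell_out m s. x (cell_path u s v))"
    unfolding flux_def by (simp only:) (rule finsum_reindex; auto simp: x inj_on_def)
qed

text \<open>For a cell with two in- and two out-neighbours, the first and third families leave a
  single scalar, with alternating signs on its four sides. The middle family is the cycle condition
  at the side joining \<open>u\<close> and \<open>v\<close>.\<close>

lemma path_chains_moore_4_cell_sums:
  "x \<in> carrier (path_chains R (moore_digraph m) 4) \<longleftrightarrow>
    x \<in> carrier (free_module R (allowed_paths (moore_digraph m) 4)) \<and>
    (\<forall>s. \<forall>v\<in>cell_out m s. (\<Oplus>u\<in>cell_in m s. x (cell_path u s v)) = \<zero>) \<and>
    (\<forall>u v. (\<Oplus>s\<in>{s. u \<in> cell_in m s \<and> v \<in> cell_out m s}. x (cell_path u s v)) = \<zero>) \<and>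
    (\<forall>s. \<forall>u\<in>cell_in m s. (\<Oplus>v\<in>cell_out m s. x (cell_path u s v)) = \<zero>)"
    (is "_ \<longleftrightarrow> _ \<and> ?sums")
proof -
  let ?P = "allowed_paths (moore_digraph m) 4"
  have "(\<forall>i\<in>{1, 2, 3}. \<forall>ws. flux R ?P (omit_nth i) ws x = \<zero>) \<longleftrightarrow> ?sums" (is "?L \<longleftrightarrow> _")
    if "x \<in> carrier (free_module R ?P)"
  proof -
    note flux = flux_cell_path[of x, OF free_module_closed[OF that]]
    show ?thesis
    proof
      assume L: ?L
      show ?sums
      proof (intro conjI allI ballI)
        fix s v assume "v \<in> cell_out m s"
        from flux(1)[OF this] L show "(\<Oplus>u\<in>cell_in m s. x (cell_path u s v)) = \<zero>" by simp
      next
        fix u v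
        from flux(2)[of m u v] L
        show "(\<Oplus>s\<in>{s. u \<in> cell_in m s \<and> v \<in> cell_out m s}. x (cell_path u s v)) = \<zero>" by simp
      next
        fix s u assume "u \<in> cell_in m s"
        from flux(3)[OF this] L show "(\<Oplus>v\<in>cell_out m s. x (cell_path u s v)) = \<zero>" by simp
      qed
    next
      assume R: ?sums
      show ?L
      proof (intro ballI allI)
        fix i :: nat and ws assume i: "i \<in> {1, 2, 3}"
        show "flux R ?P (omit_nth i) ws x = \<zero>"
        proof (cases "\<exists>p\<in>?P. omit_nth i p = ws")
          case False
          then show ?thesis by (intro flux_eq_zero) blast
        next
          case True
          then obtain u s v where usv: "u \<in> cell_in m s" "v \<in> cell_out m s"
            and ws: "ws = omit_nth i (cell_path u s v)"
            by (auto simp: allowed_paths_moore_4)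
          consider "i = 1" | "i = 2" | "i = 3" using i by auto
          then show ?thesis
          proof cases
            case 1
            with R usv show ?thesis unfolding ws 1 omit_nth_cell_path flux(1)[OF usv(2)] by blast
          next
            case 2
            with R show ?thesis unfolding ws 2 omit_nth_cell_path flux(2) by blast
          next
            case 3
            with R usv show ?thesis unfolding ws 3 omit_nth_cell_path flux(3)[OF usv(1)] by blast
          qed
        qed
      qed
    qed
  qed
  then show ?thesis unfolding path_chains_moore_4 by blast
qed

end

text \<open>
  The orientation of the disc: its fundamental chain has coefficient \<open>1\<close> on the path through
  \<open>u, s, v\<close> if this holds and \<open>-1\<close> otherwise.
\<close>

fun positive :: "nat \<Rightarrow> vertex \<Rightarrow> vertex \<Rightarrow> vertex \<Rightarrow> bool" where
  "positive m u (SqA j) v \<longleftrightarrow> (u = Poly1 j \<longleftrightarrow> v = Poly3 j)"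
| "positive m u (SqB j) v \<longleftrightarrow> (u = Poly1 j \<longleftrightarrow> v = Rim3 (even j))"
| "positive m u (Fan j) v \<longleftrightarrow> (u = Poly1 j \<longleftrightarrow> v = Poly3 (Suc j mod m))"
| "positive m u _ v \<longleftrightarrow> True"

definition moore_cycle :: "('a, 'm) ring_scheme \<Rightarrow> nat \<Rightarrow> 'a \<Rightarrow> nat list \<Rightarrow> 'a" where
  "moore_cycle R m c p = (if p \<in> allowed_paths (moore_digraph m) 4 then
      (if positive m (from_nat (p ! 1)) (from_nat (p ! 2)) (from_nat (p ! 3)) then c else \<ominus>\<^bsub>R\<^esub> c)
    else \<zero>\<^bsub>R\<^esub>)"

lemma moore_cycle_cell_path:
  "u \<in> cell_in m s \<Longrightarrow> v \<in> cell_out m s \<Longrightarrow>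
    moore_cycle R m c (cell_path u s v) = (if positive m u s v then c else \<ominus>\<^bsub>R\<^esub> c)"
proof -
  assume "u \<in> cell_in m s" "v \<in> cell_out m s"
  then have "cell_path u s v \<in> allowed_paths (moore_digraph m) 4"
    by (auto simp: allowed_paths_moore_4)
  then show ?thesis by (simp add: moore_cycle_def) (simp add: cell_path_def eval_nat_numeral)
qed

text \<open>The rim label of an index is its parity. It must alternate also when the index wraps
  around from \<open>m - 1\<close> to 0, which is what evenness gives; together with positivity it
  yields \<open>m \<ge> 2\<close>, so that neighbouring polygon vertices are distinct.\<close>

locale even_polygon =
  fixes m :: nat
  assumes even_m: "even m" and m_pos: "m > 0"
begin

abbreviation nxt :: "nat \<Rightarrow> nat" where "nxt j \<equiv> Suc j mod m"

lemma nxt_less: "nxt j < m"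
  using m_pos by simp

lemma even_nxt: "even (nxt j) \<longleftrightarrow> odd j"
  using even_m by (simp add: dvd_mod_iff)

lemma nxt_neq: "nxt j \<noteq> j"
  using even_nxt by metis

lemma nxt_inject: "i < m \<Longrightarrow> j < m \<Longrightarrow> nxt i = nxt j \<longleftrightarrow> i = j"
  by (auto simp: mod_Suc split: if_splits)

lemma nxt_surj: "k < m \<Longrightarrow> \<exists>j<m. k = nxt j"
proof (cases k)
  case 0
  then show ?thesis using m_pos by (intro exI[of _ "m - 1"]) simp
next
  case (Suc j)
  then show "k < m \<Longrightarrow> ?thesis" by (intro exI[of _ j]) simp
qed

text \<open>The squares that share the side from \<open>u\<close> to \<open>v\<close>: two at an
  interior side of the disc, \<open>m div 2\<close> at a side of the rim.\<close>

definition between :: "vertex \<Rightarrow> vertex \<Rightarrow> vertex set" where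
  "between u v = {s. u \<in> cell_in m s \<and> v \<in> cell_out m s}"

lemma mem_between: 
  "s \<in> between u v \<longleftrightarrow> (case s of
     SqA j \<Rightarrow> j < m \<and> u \<in> {Rim1 (even j), Poly1 j} \<and> v \<in> {Poly3 j, Rim3 (even j)}
   | SqB j \<Rightarrow> j < m \<and> u \<in> {Rim1 (odd j), Poly1 j} \<and> v \<in> {Poly3 (nxt j), Rim3 (even j)}
   | Fan j \<Rightarrow> j < m \<and> u \<in> {Hub, Poly1 j} \<and> v \<in> {Poly3 j, Poly3 (nxt j)}
   | _ \<Rightarrow> False)"
  by (cases s) (auto simp: between_def)

lemma between_Hub: "j < m \<Longrightarrow> between Hub (Poly3 (nxt j)) = {Fan j, Fan (nxt j)}"
  by (auto simp: mem_between nxt_inject nxt_less split: vertex.splits)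

lemma between_Poly1_same: "j < m \<Longrightarrow> between (Poly1 j) (Poly3 j) = {SqA j, Fan j}"
  using nxt_neq[of j] by (auto simp: mem_between split: vertex.splits)

lemma between_Poly1_next: "j < m \<Longrightarrow> between (Poly1 j) (Poly3 (nxt j)) = {SqB j, Fan j}"
  using nxt_neq[of j] by (auto simp: mem_between split: vertex.splits)

lemma between_Poly1_Rim3: "j < m \<Longrightarrow> between (Poly1 j) (Rim3 (even j)) = {SqA j, SqB j}"
  by (auto simp: mem_between split: vertex.splits)

lemma between_Rim1_Poly3: "j < m \<Longrightarrow> between (Rim1 (odd j)) (Poly3 (nxt j)) = {SqB j, SqA (nxt j)}"
  by (auto simp: mem_between nxt_inject nxt_less even_nxt split: vertex.splits)

lemma between_Rim_same: "between (Rim1 b) (Rim3 b) = SqA ` {j \<in> {..<m}. even j = b}"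
  by (auto simp: mem_between split: vertex.splits)

lemma between_Rim_opposite: "between (Rim1 (\<not> b)) (Rim3 b) = SqB ` {j \<in> {..<m}. even j = b}"
  by (auto simp: mem_between split: vertex.splits)

text \<open>The sides of the complex: spokes at the hub, the two kinds of polygon sides, the two
  kinds of sides joining polygon and rim, and the two kinds of rim sides.\<close>

lemma between_cases:
  obtains "between u v = {}"
  | j where "j < m" "u = Hub" "v = Poly3 (nxt j)"
  | j where "j < m" "u = Poly1 j" "v = Poly3 j"
  | j where "j < m" "u = Poly1 j" "v = Poly3 (nxt j)"
  | j where "j < m" "u = Poly1 j" "v = Rim3 (even j)"
  | j where "j < m" "u = Rim1 (odd j)" "v = Poly3 (nxt j)"
  | b where "u = Rim1 b" "v = Rim3 b"
  | b where "u = Rim1 (\<not> b)" "v = Rim3 b"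
proof (cases "between u v = {}")
  case False
  then obtain s where "s \<in> between u v" by blast
  then consider
      j where "j < m" "u = Rim1 (even j) \<or> u = Poly1 j" "v = Poly3 j \<or> v = Rim3 (even j)"
    | j where "j < m" "u = Rim1 (odd j) \<or> u = Poly1 j" "v = Poly3 (nxt j) \<or> v = Rim3 (even j)"
    | j where "j < m" "u = Hub \<or> u = Poly1 j" "v = Poly3 j \<or> v = Poly3 (nxt j)"
    unfolding mem_between by (cases s) auto
  then show thesis
  proof cases
    case (1 j)
    \<comment> \<open>Sides joining the rim or the hub to \<open>Poly3\<close> are listed by the
      predecessor index, so \<open>j\<close> is rewritten as a successor; this flips the parity in
      the rim label.\<close>
    obtain k where k: "k < m" "j = nxt k" using nxt_surj 1(1) by blast
    then have "even j = odd k" by (simp only: even_nxt)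
    then have "v = Poly3 (nxt k)" if "v = Poly3 j" using k that by simp
    then show thesis
      using 1(2,3) \<open>even j = odd k\<close> that(3,5)[OF 1(1)] that(6)[OF k(1)] that(7)[of "even j"]
      by (elim disjE) simp_all
  next
    case (2 j)
    with that show thesis by metis
  next
    case (3 j)
    obtain k where k: "k < m" "j = nxt k" using nxt_surj 3(1) by blast
    then have "v = Poly3 (nxt k)" if "v = Poly3 j" using that by simp
    then show thesis
      using 3(2,3) that(2)[OF 3(1)] that(3,4)[OF 3(1)] that(2)[OF k(1)] by (elim disjE) simp_all
  qed
qed (rule that(1))

text \<open>One turn around the rim consumes two consecutive indices, one of each parity, so this
  counts the turns.\<close>

lemma card_parity: "card {j \<in> {..<m}. even j = b} = m div 2"
proof -
  have "bij_betw (\<lambda>i. 2 * i + (if b then 0 else 1)) {..<m div 2} {j \<in> {..<m}. even j = b}"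
    using even_m
    by (intro bij_betwI[where g = "\<lambda>j. j div 2"]; cases b; auto elim!: evenE oddE; presburger)
  then show ?thesis using bij_betw_same_card by fastforce
qed

end

section \<open>Four-chains as multiples of the fundamental chain of the disc\<close>

context even_polygon
begin

text \<open>The orientation makes the signs cancel inside every cell and between the two cells at
  every interior side. At a rim side all cells carry the same sign, and what remains is plus or
  minus \<open>m div 2\<close> times \<open>c\<close>.\<close>

lemma moore_cycle_in_path_chains:
  fixes R (structure)
  assumes "cring R" and c: "c \<in> carrier R" "[(m div 2)] \<cdot> c = \<zero>"
  shows "moore_cycle R m c \<in> carrier (path_chains R (moore_digraph m) 4)"
proof -
  interpret cring R by fact
  let ?x = "moore_cycle R m c"
  have fin: "finite (allowed_paths (moore_digraph m) 4)"
    by (rule finite_allowed_paths[OF pair_fin_digraph.pair_finite_verts])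
       (rule pair_digraph.axioms(1)[OF pair_digraph_moore])
  have "?x \<in> carrier (free_module R (allowed_paths (moore_digraph m) 4))"
    using c(1) rev_finite_subset[OF fin, of "{p. ?x p \<noteq> \<zero>}"]
    unfolding free_module_def by (auto simp: moore_cycle_def intro: rev_finite_subset[OF fin])
  moreover have "(\<Oplus>u\<in>cell_in m s. ?x (cell_path u s v)) = \<zero>" if "v \<in> cell_out m s" for s v
  proof -
    have "(\<Oplus>u\<in>cell_in m s. ?x (cell_path u s v)) =
        (\<Oplus>u\<in>cell_in m s. if positive m u s v then c else \<ominus> c)"
      using that c(1) by (intro finsum_cong') (auto simp: moore_cycle_cell_path)
    also have "\<dots> = \<zero>"
      using that c(1) by (cases s) (auto simp: r_neg l_neg split: if_splits)
    finally show ?thesis .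
  qed
  moreover have "(\<Oplus>v\<in>cell_out m s. ?x (cell_path u s v)) = \<zero>" if "u \<in> cell_in m s" for s u
  proof -
    have "(\<Oplus>v\<in>cell_out m s. ?x (cell_path u s v)) =
        (\<Oplus>v\<in>cell_out m s. if positive m u s v then c else \<ominus> c)"
      using that c(1) by (intro finsum_cong') (auto simp: moore_cycle_cell_path)
    also have "\<dots> = \<zero>"
      using that c(1) by (cases s) (auto simp: nxt_neq nxt_neq[symmetric] r_neg l_neg split: if_splits)
    finally show ?thesis .
  qed
  moreover have "(\<Oplus>s\<in>between u v. ?x (cell_path u s v)) = \<zero>" for u v
  proof -
    have "(\<Oplus>s\<in>between u v. ?x (cell_path u s v)) =
        (\<Oplus>s\<in>between u v. if positive m u s v then c else \<ominus> c)"
      using c(1) by (intro finsum_cong') (auto simp: moore_cycle_cell_path between_def)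
    also have "\<dots> = \<zero>"
    proof (cases u v rule: between_cases)
      case 1
      then show ?thesis by (simp only: finsum_empty)
    next
      case (2 j)
      then show ?thesis
        using c(1) nxt_neq[of j] nxt_neq[of "nxt j"] by (simp add: between_Hub r_neg l_neg)
    next
      case (3 j)
      then show ?thesis
        using c(1) nxt_neq[of j] by (simp add: between_Poly1_same r_neg l_neg)
    next
      case (4 j)
      then show ?thesis
        using c(1) by (simp add: between_Poly1_next r_neg l_neg)
    next
      case (5 j)
      then show ?thesis
        using c(1) by (simp add: between_Poly1_Rim3 r_neg l_neg)
    next
      case (6 j)
      then show ?thesis
        using c(1) by (simp add: between_Rim1_Poly3[simplified] r_neg l_neg)
    next
      case (7 b)
      have "(\<Oplus>s\<in>between u v. if positive m u s v then c else \<ominus> c) = (\<Oplus>s\<in>between u v. c)"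
        using c(1) 7 by (intro finsum_cong') (auto simp: between_Rim_same)
      also have "\<dots> = [(card (between u v))] \<cdot> c"
        by (rule add.finprod_const[OF c(1)])
      also have "card (between u v) = m div 2"
        unfolding 7 between_Rim_same by (simp add: card_image inj_on_def card_parity[simplified])
      finally show ?thesis using c(2) by simp
    next
      case (8 b)
      have "(\<Oplus>s\<in>between u v. if positive m u s v then c else \<ominus> c) = (\<Oplus>s\<in>between u v. \<ominus> c)"
        using c(1) 8 by (intro finsum_cong') (auto simp: between_Rim_opposite)
      also have "\<dots> = [(card (between u v))] \<cdot> (\<ominus> c)"
        by (rule add.finprod_const) (simp add: c(1))
      also have "card (between u v) = m div 2"
        unfolding 8 between_Rim_opposite by (simp add: card_image inj_on_def card_parity[simplified])
      also have "[(m div 2)] \<cdot> (\<ominus> c) = \<ominus> ([(m div 2)] \<cdot> c)"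
        using add_pow_ldistr[of c "\<ominus> \<one>" "m div 2"] c(1) by (simp add: r_minus)
      finally show ?thesis using c(2) by simp
    qed
    finally show ?thesis .
  qed
  ultimately show ?thesis
    unfolding path_chains_moore_4_cell_sums between_def by blast
qed

text \<open>The disc is connected through its interior sides, so one value determines a cycle: it
  spreads from \<open>Fan 0\<close> along the spokes to all fans, then across the polygon sides to
  the squares of the annulus. The rim then gives the equation for \<open>c\<close>.\<close>

lemma path_chains_moore_4_cyclic:
  fixes R (structure)
  assumes "cring R" and x: "x \<in> carrier (path_chains R (moore_digraph m) 4)"
  defines "c \<equiv> x (cell_path Hub (Fan 0) (Poly3 0))"
  shows "x = moore_cycle R m c" "[(m div 2)] \<cdot> c = \<zero>"
proof -
  interpret cring R by fact
  let ?P = "allowed_paths (moore_digraph m) 4"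
  define X where "X u s v = x (cell_path u s v)" for u s v
  have xf: "x \<in> carrier (free_module R ?P)"
    and low: "\<And>s v. v \<in> cell_out m s \<Longrightarrow> (\<Oplus>u\<in>cell_in m s. X u s v) = \<zero>"
    and mid: "\<And>u v. (\<Oplus>s\<in>between u v. X u s v) = \<zero>"
    and high: "\<And>s u. u \<in> cell_in m s \<Longrightarrow> (\<Oplus>v\<in>cell_out m s. X u s v) = \<zero>"
    using x unfolding path_chains_moore_4_cell_sums between_def X_def by blast+
  have X [simp]: "X u s v \<in> carrier R" for u s v
    unfolding X_def by (rule free_module_closed[OF xf])
  have c: "c = X Hub (Fan 0) (Poly3 0)" by (simp add: c_def X_def)
  have neg: "b = \<ominus> a" if "a \<oplus> b = \<zero>" "a \<in> carrier R" "b \<in> carrier R" for a b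
    using minus_equality[of b a] that by (simp add: a_comm)
  have hub: "X (Poly1 j) (Fan j) (Poly3 j) = \<ominus> X Hub (Fan j) (Poly3 j)"
    "X Hub (Fan j) (Poly3 (nxt j)) = \<ominus> X Hub (Fan j) (Poly3 j)"
    "X (Poly1 j) (Fan j) (Poly3 (nxt j)) = X Hub (Fan j) (Poly3 j)" if "j < m" for j
  proof -
    show 1: "X (Poly1 j) (Fan j) (Poly3 j) = \<ominus> X Hub (Fan j) (Poly3 j)"
      using low[of "Poly3 j" "Fan j"] that by (intro neg) simp_all
    show "X Hub (Fan j) (Poly3 (nxt j)) = \<ominus> X Hub (Fan j) (Poly3 j)"
      using high[of Hub "Fan j"] that nxt_neq[of j] by (intro neg) simp_all
    have "X (Poly1 j) (Fan j) (Poly3 (nxt j)) = \<ominus> X (Poly1 j) (Fan j) (Poly3 j)"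
      using high[of "Poly1 j" "Fan j"] that nxt_neq[of j] by (intro neg) simp_all
    then show "X (Poly1 j) (Fan j) (Poly3 (nxt j)) = X Hub (Fan j) (Poly3 j)"
      by (simp add: 1)
  qed
  \<comment> \<open>Passing from one fan to the next costs two sign changes, one inside the fan and
    one across the common spoke, so the value is unchanged.\<close>
  have hub_const: "X Hub (Fan j) (Poly3 j) = c" if "j < m" for j
    using that
  proof (induction j)
    case 0
    then show ?case by (simp add: c)
  next
    case (Suc j)
    then have j: "j < m" and nx: "nxt j = Suc j" by simp_all
    have "X Hub (Fan j) (Poly3 (nxt j)) \<oplus> X Hub (Fan (nxt j)) (Poly3 (nxt j)) = \<zero>"
      using mid[of Hub "Poly3 (nxt j)"] nxt_neq[of j] by (simp add: between_Hub[OF j])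
    then have "X Hub (Fan (Suc j)) (Poly3 (Suc j)) = \<ominus> X Hub (Fan j) (Poly3 (nxt j))"
      unfolding nx by (rule neg) simp_all
    then show ?case using Suc.IH j by (simp add: hub c)
  qed
  have cc: "c \<in> carrier R" by (simp add: c)
  have A: "X (Poly1 j) (SqA j) (Poly3 j) = c" "X (Rim1 (even j)) (SqA j) (Poly3 j) = \<ominus> c"
    "X (Poly1 j) (SqA j) (Rim3 (even j)) = \<ominus> c" "X (Rim1 (even j)) (SqA j) (Rim3 (even j)) = c"
    if j: "j < m" for j
  proof -
    have "X (Poly1 j) (Fan j) (Poly3 j) \<oplus> X (Poly1 j) (SqA j) (Poly3 j) = \<zero>"
      using mid[of "Poly1 j" "Poly3 j"] by (simp add: between_Poly1_same[OF j] a_comm)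
    from neg[OF this] show 1: "X (Poly1 j) (SqA j) (Poly3 j) = c"
      using cc by (simp add: hub j hub_const)
    have "X (Poly1 j) (SqA j) v \<oplus> X (Rim1 (even j)) (SqA j) v = \<zero>"
      if "v \<in> {Poly3 j, Rim3 (even j)}" for v
      using low[of v "SqA j"] that j by (simp add: a_comm)
    note l = neg[OF this]
    show "X (Rim1 (even j)) (SqA j) (Poly3 j) = \<ominus> c"
      using l[of "Poly3 j"] cc by (simp add: 1)
    have "X (Poly1 j) (SqA j) (Poly3 j) \<oplus> X (Poly1 j) (SqA j) (Rim3 (even j)) = \<zero>"
      using high[of "Poly1 j" "SqA j"] j by simp
    from neg[OF this] show 2: "X (Poly1 j) (SqA j) (Rim3 (even j)) = \<ominus> c"
      using cc by (simp add: 1)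
    show "X (Rim1 (even j)) (SqA j) (Rim3 (even j)) = c"
      using l[of "Rim3 (even j)"] cc by (simp add: 2)
  qed
  have B: "X (Poly1 j) (SqB j) (Poly3 (nxt j)) = \<ominus> c" "X (Rim1 (odd j)) (SqB j) (Poly3 (nxt j)) = c"
    "X (Poly1 j) (SqB j) (Rim3 (even j)) = c" "X (Rim1 (odd j)) (SqB j) (Rim3 (even j)) = \<ominus> c"
    if j: "j < m" for j
  proof -
    have "X (Poly1 j) (Fan j) (Poly3 (nxt j)) \<oplus> X (Poly1 j) (SqB j) (Poly3 (nxt j)) = \<zero>"
      using mid[of "Poly1 j" "Poly3 (nxt j)"] by (simp add: between_Poly1_next[OF j] a_comm)
    from neg[OF this] show 1: "X (Poly1 j) (SqB j) (Poly3 (nxt j)) = \<ominus> c"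
      using cc by (simp add: hub j hub_const)
    have "X (Poly1 j) (SqB j) v \<oplus> X (Rim1 (odd j)) (SqB j) v = \<zero>"
      if "v \<in> {Poly3 (nxt j), Rim3 (even j)}" for v
      using low[of v "SqB j"] that j by (simp add: a_comm)
    note l = neg[OF this]
    show "X (Rim1 (odd j)) (SqB j) (Poly3 (nxt j)) = c"
      using l[of "Poly3 (nxt j)"] cc by (simp add: 1)
    have "X (Poly1 j) (SqB j) (Poly3 (nxt j)) \<oplus> X (Poly1 j) (SqB j) (Rim3 (even j)) = \<zero>"
      using high[of "Poly1 j" "SqB j"] j by simp
    from neg[OF this] show 2: "X (Poly1 j) (SqB j) (Rim3 (even j)) = c"
      using cc by (simp add: 1)
    show "X (Rim1 (odd j)) (SqB j) (Rim3 (even j)) = \<ominus> c"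
      using l[of "Rim3 (even j)"] cc by (simp add: 2)
  qed
  have val: "X u s v = (if positive m u s v then c else \<ominus> c)"
    if "u \<in> cell_in m s" "v \<in> cell_out m s" for u s v
    using that by (cases s) (auto simp: A B hub hub_const nxt_neq nxt_neq[symmetric] A[simplified] B[simplified] split: if_splits)
  show "x = moore_cycle R m c"
  proof
    fix p
    show "x p = moore_cycle R m c p"
    proof (cases "p \<in> ?P")
      case True
      then show ?thesis using val by (auto simp: allowed_paths_moore_4 moore_cycle_cell_path X_def)
    next
      case False
      then show ?thesis using free_module_support(2)[OF xf] by (simp add: moore_cycle_def)
    qed
  qed
  \<comment> \<open>All rim sides give the same equation up to sign, so a single one is
    evaluated.\<close>
  have AT: "X (Rim1 True) (SqA j) (Rim3 True) = c" if "j < m" "even j" for j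
    using A(4)[OF that(1)] that(2) by simp
  have "\<zero> = (\<Oplus>s\<in>between (Rim1 True) (Rim3 True). X (Rim1 True) s (Rim3 True))"
    by (simp add: mid)
  also have "\<dots> = (\<Oplus>s\<in>between (Rim1 True) (Rim3 True). c)"
    using AT cc by (intro finsum_cong') (auto simp: between_Rim_same)
  also have "\<dots> = [(card (between (Rim1 True) (Rim3 True)))] \<cdot> c"
    by (rule add.finprod_const[OF cc])
  also have "card (between (Rim1 True) (Rim3 True)) = m div 2"
    unfolding between_Rim_same using card_parity[of True] by (simp add: card_image inj_on_def)
  finally show "[(m div 2)] \<cdot> c = \<zero>" by simp
qed

end

text \<open>Multiples of one are multiplicative in the multiplier and a field has no zero divisors,
  so a vanishing multiple \<open>t\<close> has a prime factor that already vanishes. The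
  characteristic divides this prime and is not 1.\<close>

lemma (in field) exists_prime_factor_char_iff:
  assumes "t > 0"
  shows "(\<exists>p\<in>prime_factors t. ring_char R = p) \<longleftrightarrow> [t] \<cdot> \<one> = \<zero>"
proof -
  have mult: "[(a * b)] \<cdot> \<one> = [a] \<cdot> \<one> \<otimes> [b] \<cdot> \<one>" for a b :: nat
    using add_pow_ldistr[of \<one> "[b] \<cdot> \<one>" a] by (simp add: add.nat_pow_pow mult.commute)
  have char_zero: "[ring_char R] \<cdot> \<one> = \<zero>"
    unfolding ring_char_def using LeastI_ex[of "\<lambda>n. n > 0 \<and> [n] \<cdot> \<one> = \<zero>"] by auto
  show ?thesis
  proof
    assume "\<exists>p\<in>prime_factors t. ring_char R = p"
    then have "ring_char R dvd t" by auto
    then obtain k where "t = ring_char R * k" by (elim dvdE)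
    then show "[t] \<cdot> \<one> = \<zero>" using mult char_zero by simp
  next
    assume t: "[t] \<cdot> \<one> = \<zero>"
    have "\<exists>p\<in>prime_factors t. [p] \<cdot> \<one> = \<zero>"
      using assms t
    proof (induction t rule: prime_divisors_induct)
      case (unit t)
      then show ?case by simp
    next
      case (factor p t)
      then have "[p] \<cdot> \<one> = \<zero> \<or> [t] \<cdot> \<one> = \<zero>"
        using integral[of "[p] \<cdot> \<one>" "[t] \<cdot> \<one>"] by (simp add: mult)
      then show ?case
      proof
        assume "[p] \<cdot> \<one> = \<zero>"
        then show ?thesis using factor.hyps factor.prems by (intro bexI[of _ p]) (auto simp: prime_factors_dvd)
      next
        assume "[t] \<cdot> \<one> = \<zero>"
        then obtain q where "q \<in> prime_factors t" "[q] \<cdot> \<one> = \<zero>"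
          using factor.IH factor.prems by auto
        then show ?thesis using factor.prems by (intro bexI[of _ q]) (auto simp: prime_factors_dvd)
      qed
    qed simp
    then obtain p where p: "p \<in> prime_factors t" "[p] \<cdot> \<one> = \<zero>" by blast
    then have pp: "prime p" by auto
    then have ex: "p > 0 \<and> [p] \<cdot> \<one> = \<zero>" using p(2) prime_gt_0_nat by blast
    have pos: "ring_char R > 0"
      unfolding ring_char_def using ex LeastI[of "\<lambda>n. n > 0 \<and> [n] \<cdot> \<one> = \<zero>" p] by auto
    have least: "ring_char R \<le> n" if "n > 0" "[n] \<cdot> \<one> = \<zero>" for n
      unfolding ring_char_def using that Least_le[of "\<lambda>n. n > 0 \<and> [n] \<cdot> \<one> = \<zero>" n] by auto
    \<comment> \<open>Division with remainder: the remainder also annihilates one and is below the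
      least positive such number, so it is zero.\<close>
    have "[p] \<cdot> \<one> = [(p div ring_char R * ring_char R)] \<cdot> \<one> \<oplus> [(p mod ring_char R)] \<cdot> \<one>"
      by (simp add: add.nat_pow_mult)
    then have "[(p mod ring_char R)] \<cdot> \<one> = \<zero>"
      using p(2) by (simp add: mult char_zero)
    then have "p mod ring_char R = 0"
      using least[of "p mod ring_char R"] pos mod_less_divisor[of "ring_char R" p] by linarith
    then have "ring_char R dvd p" by auto
    moreover have "ring_char R \<noteq> 1"
    proof
      assume "ring_char R = 1"
      then show False using char_zero by simp
    qed
    ultimately have "ring_char R = p" using pp prime_nat_iff by blast
    then show "\<exists>p\<in>prime_factors t. ring_char R = p" using p(1) by blast
  qed
qed

text \<open>Chains correspond to scalars \<open>c\<close> with \<open>t\<close> times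
  \<open>c\<close> equal to zero, as \<open>2 * t div 2\<close> is \<open>t\<close>. In a field
  these are all scalars or only zero. The path through the hub serves as the single coordinate
  because its sign in the fundamental chain is positive.\<close>

lemma dim_path_chains_moore_4:
  fixes K (structure)
  assumes "field K" "t > 0"
  shows "vectorspace.dim K (path_chains K (moore_digraph (2 * t)) 4) =
    (if [t] \<cdot> \<one> = \<zero> then 1 else 0)"
proof -
  interpret K: field K by fact
  interpret even_polygon "2 * t" by standard (use assms(2) in auto)
  let ?W = "carrier (path_chains K (moore_digraph (2 * t)) 4)"
  let ?p = "cell_path Hub (Fan 0) (Poly3 0)"
  note cyc = path_chains_moore_4_cyclic[OF K.is_cring]
  have cl: "x p \<in> carrier K" if "x \<in> ?W" for x p
    using that unfolding K.path_chains_moore_4 by (auto intro: K.free_module_closed)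
  have scale: "[t] \<cdot> c = [t] \<cdot> \<one> \<otimes> c" if "c \<in> carrier K" for c
    using K.add_pow_ldistr[of \<one> c t] that by simp
  show ?thesis
  proof (cases "[t] \<cdot> \<one> = \<zero>")
    case True
    have in_W: "moore_cycle K (2 * t) c \<in> ?W" if "c \<in> carrier K" for c
      using moore_cycle_in_path_chains[OF K.is_cring that] scale[OF that] True that by simp
    have at_p: "moore_cycle K (2 * t) c ?p = c" for c
      using assms(2) nxt_neq[of 0] by (subst moore_cycle_cell_path) auto
    have "coordinates K ?W {?p}"
      unfolding coordinates_def
    proof (intro allI impI)
      fix z assume z: "\<forall>e\<in>{?p}. z e \<in> carrier K"
      show "\<exists>!x. x \<in> ?W \<and> (\<forall>e\<in>{?p}. x e = z e)"
      proof (rule ex1I[of _ "moore_cycle K (2 * t) (z ?p)"])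
        show "moore_cycle K (2 * t) (z ?p) \<in> ?W \<and> (\<forall>e\<in>{?p}. moore_cycle K (2 * t) (z ?p) e = z e)"
          using in_W at_p z by simp
      next
        fix x assume "x \<in> ?W \<and> (\<forall>e\<in>{?p}. x e = z e)"
        then show "x = moore_cycle K (2 * t) (z ?p)" using cyc(1)[of x] by simp
      qed
    qed
    from dim_path_chains[OF assms(1) pair_digraph_moore _ this] show ?thesis
      using True by simp
  next
    case False
    have "x = moore_cycle K (2 * t) \<zero>" if x: "x \<in> ?W" for x
    proof -
      have "[t] \<cdot> \<one> \<otimes> x ?p = \<zero>" using cyc(2)[OF x] scale[OF cl[OF x]] by simp
      then have "x ?p = \<zero>" using False K.integral cl[OF x] by auto
      then show ?thesis using cyc(1)[OF x] by simp
    qed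
    moreover have "moore_cycle K (2 * t) \<zero> \<in> ?W"
      by (rule moore_cycle_in_path_chains[OF K.is_cring]) simp_all
    ultimately have "coordinates K ?W {}"
      unfolding coordinates_def by auto
    from dim_path_chains[OF assms(1) pair_digraph_moore _ this] show ?thesis
      using False by simp
  qed
qed

theorem theorem1p4:
  fixes t :: nat
  assumes "t \<ge> 2"
  shows "\<exists>E :: nat pair_pre_digraph. pair_digraph E \<and>
    (\<forall>(K :: 'a ring) (K' :: 'b ring). field K \<longrightarrow> field K' \<longrightarrow>
      vectorspace.dim K (path_chains K E 4) =
        (if \<exists>p \<in> prime_factors t. ring_char K = p then 1 else 0) \<and>
      (\<forall>i :: int. i \<noteq> 4 \<longrightarrow>
        vectorspace.dim K (path_chains K E i) = vectorspace.dim K' (path_chains K' E i)))"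
proof (intro exI[of _ "moore_digraph (2 * t)"] conjI allI impI)
  show "pair_digraph (moore_digraph (2 * t))" by (rule pair_digraph_moore)
next
  fix K :: "'a ring" and K' :: "'b ring"
  assume "field K"
  then show "vectorspace.dim K (path_chains K (moore_digraph (2 * t)) 4) =
      (if \<exists>p \<in> prime_factors t. ring_char K = p then 1 else 0)"
    using assms dim_path_chains_moore_4[of K t] field.exists_prime_factor_char_iff[of K t] by simp
next
  fix K :: "'a ring" and K' :: "'b ring" and i :: int
  assume K: "field K" "field K'" and "i \<noteq> 4"
  then consider "i \<le> 3" | "i \<ge> 5" by linarith
  then show "vectorspace.dim K (path_chains K (moore_digraph (2 * t)) i) =
      vectorspace.dim K' (path_chains K' (moore_digraph (2 * t)) i)"
  proof cases
    case 1
    then show ?thesis by (rule dim_path_chains_field_independent[OF K pair_digraph_moore])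
  next
    case 2
    then show ?thesis
      using K by (simp add: dim_path_chains_no_paths pair_digraph_moore allowed_paths_moore_ge_5)
  qed
qed

end
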